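(* Let $(X_i)_{i\in\mathbb Z}$ be a strictly stationary sequence of random variables with values in a separable metric space $(S,d)$, let $\mathbb H$ be a separable Hilbert space, and let $h\colon S\times S\to\mathbb H$ be a measurable function ($S\times S$ is endowed with the product $\sigma$-algebra and $\mathbb H$ with the $\sigma$-algebra induced by the norm). Let $X_1'$ be an independent copy of $X_1$ and suppose that, almost surely, $$\mathbb E[h(X_1,X_1')\mid X_1]=\mathbb E[h(X_1,X_1')\mid X_1']=0.$$ Let $1<p<2$ and $\delta>0$ be such that $p+\delta\ge2$. Assume that $$\mathbb E\bigl[\|h(X_1,X_1')\|_{\mathbb H}^{p+\delta}\bigr]<\infty,\qquad \sup_{j\ge2}\mathbb E\bigl[\|h(X_1,X_j)\|_{\mathbb H}\bigr]<\infty,$$ and that there exists $\eta>0$ such that $$\sum_{k=1}^\infty k^{\frac{2(p-1)}{2-p}+\eta}\beta(k)<\infty.$$ Then $$\lim_{n\to\infty}\frac1{n^{2/p}}\|U_n(h)\|_{\mathbb H}=0\quad\text{almost surely.}$$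
   Context: $U_n(h)=\sum_{1\le i<j\le n}h(X_i,X_j)$. For sub-$\sigma$-algebras $\mathcal A,\mathcal B$ of a probability space, $\beta(\mathcal A,\mathcal B)=\frac12\sup\sum_{i=1}^I\sum_{j=1}^J|\mathbb P(A_i\cap B_j)-\mathbb P(A_i)\mathbb P(B_j)|$, the supremum being over all finite partitions $(A_i)_{i=1}^I$, $(B_j)_{j=1}^J$ of $\Omega$ into elements of $\mathcal A$ and $\mathcal B$ respectively. For the sequence, $\beta(k)=\sup_{\ell\ge1}\beta(\mathcal F_1^\ell,\mathcal F_{\ell+k}^\infty)$, where $\mathcal F_u^v=\sigma(X_i,\,u\le i\le v)$ ($\sigma(X_i,\,i\ge u)$ if $v=\infty$). *)

theory Defs
  imports "HOL-Probability.Probability"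
begin

definition strictly_stationary ::
    "'w measure \<Rightarrow> (int \<Rightarrow> 'w \<Rightarrow> 's::topological_space) \<Rightarrow> bool" where
  "strictly_stationary M X \<longleftrightarrow>
     (\<forall>k::int. distr M (\<Pi>\<^sub>M i\<in>UNIV. borel) (\<lambda>\<omega> i. X (i + k) \<omega>)
             = distr M (\<Pi>\<^sub>M i\<in>UNIV. borel) (\<lambda>\<omega> i. X i \<omega>))"

text \<open>
  The library's \<^const>\<open>real_cond_exp\<close> covers real-valued functions only. The following says
  that \<open>g\<close> is a version of the conditional expectation of the Banach-space valued \<open>f\<close> given
  the sub-\<open>\<sigma>\<close>-algebra \<open>F\<close>. Versions agree almost surely, so the conditional expectation
  vanishes almost surely exactly when the zero function is a version of it.
\<close>

definition has_cond_exp ::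
    "'w measure \<Rightarrow> 'w measure \<Rightarrow> ('w \<Rightarrow> 'b::{banach, second_countable_topology}) \<Rightarrow> ('w \<Rightarrow> 'b) \<Rightarrow> bool"
  where
  "has_cond_exp M F f g \<longleftrightarrow>
     integrable M f \<and> integrable M g \<and> g \<in> borel_measurable F \<and>
     (\<forall>A\<in>sets F. (LINT \<omega>:A|M. f \<omega>) = (LINT \<omega>:A|M. g \<omega>))"

definition gen_sigma ::
    "'w measure \<Rightarrow> (int \<Rightarrow> 'w \<Rightarrow> 's::topological_space) \<Rightarrow> int set \<Rightarrow> 'w measure" where
  "gen_sigma M X I = sigma (space M) {X i -` B \<inter> space M | i B. i \<in> I \<and> B \<in> sets borel}"

text \<open>
  Both suprema below are of nonempty sets of reals that are bounded above (by 1) when \<open>M\<close> is a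
  probability space and \<open>A\<close>, \<open>B\<close> are sub-\<open>\<sigma>\<close>-algebras of it.
\<close>

definition beta_alg :: "'w measure \<Rightarrow> 'w measure \<Rightarrow> 'w measure \<Rightarrow> real" where
  "beta_alg M A B = 1 / 2 *
     Sup {\<Sum>a\<in>P. \<Sum>b\<in>Q. \<bar>measure M (a \<inter> b) - measure M a * measure M b\<bar> | P Q.
       finite P \<and> partition_on (space M) P \<and> P \<subseteq> sets A \<and>
       finite Q \<and> partition_on (space M) Q \<and> Q \<subseteq> sets B}"

definition beta_mix ::
    "'w measure \<Rightarrow> (int \<Rightarrow> 'w \<Rightarrow> 's::topological_space) \<Rightarrow> nat \<Rightarrow> real" where
  "beta_mix M X k =
     (SUP l\<in>{1::int..}. beta_alg M (gen_sigma M X {1..l}) (gen_sigma M X {l + int k..}))"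

definition U_stat ::
    "('s \<Rightarrow> 's \<Rightarrow> 'h::real_vector) \<Rightarrow> (int \<Rightarrow> 'w \<Rightarrow> 's) \<Rightarrow> nat \<Rightarrow> 'w \<Rightarrow> 'h" where
  "U_stat h X n \<omega> = (\<Sum>i\<in>{1..int n}. \<Sum>j\<in>{i<..int n}. h (X i \<omega>) (X j \<omega>))"

end

theory Submission
  imports Defs "HOL-Real_Asymp.Real_Asymp"
begin

text \<open>
  Fix a dyadic scale \<open>2\<^sup>N\<close> and a block length \<open>L\<close>, cut the indices into periods of length \<open>3L\<close>
  and discard the first third of each period. For a degenerate kernel evaluated at independent
  blocks, the terms \<open>h(X\<^sub>i, X\<^sub>j)\<close> with \<open>i\<close>, \<open>j\<close> in different blocks are orthogonal unless they
  use the same two blocks, so partial sums over \<open>j\<close> have second moment of order \<open>L\<^sup>2 4\<^sup>N\<close>, and the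
  Rademacher--Menshov inequality turns this into a maximal inequality at the cost of \<open>N\<^sup>2\<close>.
  Since the event in question depends on the law of the retained variables only, replacing
  the process by independent blocks costs at most \<open>2\<beta>(L)\<close> per block; no coupling lemma is
  needed. Three shifts of the cutting pattern cover all pairs, except for the \<open>O(2\<^sup>N L)\<close> pairs
  in a common period, which are controlled in \<open>L\<^sup>1\<close>. With \<open>L\<close> of order \<open>2\<^bsup>\<gamma>N\<^esup>\<close> all three
  errors are summable in \<open>N\<close> provided \<open>1/(1 + \<alpha>) < \<gamma> < (2 - p)/p\<close>, where \<open>\<alpha>\<close> is the mixing
  exponent; the mixing assumption says exactly that such a \<open>\<gamma>\<close> exists.
\<close>

text \<open>For dependent indices only a first moment of h(X_i, X_j) is assumed, so no variance can
  be computed under the original law. Total variation transfers probabilities, not moments: the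
  maximal inequality is therefore proved for independent blocks, and only the resulting event, which
  concerns finitely many variables, is carried back. Partial sums stop inside blocks too and need
  not form a martingale; Rademacher-Menshov asks only for a second moment bound linear in the length
  of every interval. A third of each period is dropped, rather than a half, because each index is
  then lost for at most one of three shifts, and two indices spoil at most two of them. With a
  threshold of order 2^(\<tau> N), \<tau> < 2/p, the second moment error has order N^2
  2^(2(1+\<gamma>-\<tau>)N), near pairs cost 2^((1+\<gamma>-\<tau>)N), and 2^N/L blocks with
  \<beta>(L) = O(L^(-\<alpha>)) cost 2^((1-\<gamma>(1+\<alpha>))N). For \<eta> = 0 one would have
  1+\<alpha> = p/(2-p), and the lower and upper bounds on \<gamma> would coincide; \<eta> > 0 opens
  the interval.\<close>

section \<open>Absolute regularity as a total variation distance\<close>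

text \<open>
  Finite unions of rectangles, encoded through finitely valued functions so that closure under
  complement and union needs no common refinement of partitions.
\<close>

definition grid_set :: "'a measure \<Rightarrow> 'b measure \<Rightarrow> ('a \<times> 'b) set \<Rightarrow> bool" where
  "grid_set A B F \<longleftrightarrow> (\<exists>(f::'a \<Rightarrow> nat) (g::'b \<Rightarrow> nat) T.
     f \<in> A \<rightarrow>\<^sub>M count_space UNIV \<and> g \<in> B \<rightarrow>\<^sub>M count_space UNIV \<and>
     finite (range f) \<and> finite (range g) \<and>
     F = {z \<in> space A \<times> space B. (f (fst z), g (snd z)) \<in> T})"

lemma grid_set_sets: "grid_set A B F \<Longrightarrow> F \<in> sets (A \<Otimes>\<^sub>M B)"
proof -
  assume "grid_set A B F"
  then obtain f :: "'a \<Rightarrow> nat" and g :: "'b \<Rightarrow> nat" and T where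
    [measurable]: "f \<in> A \<rightarrow>\<^sub>M count_space UNIV" "g \<in> B \<rightarrow>\<^sub>M count_space UNIV"
    and F: "F = {z \<in> space A \<times> space B. (f (fst z), g (snd z)) \<in> T}"
    unfolding grid_set_def by blast
  have "(\<lambda>z. (f (fst z), g (snd z))) \<in> A \<Otimes>\<^sub>M B \<rightarrow>\<^sub>M count_space UNIV"
    by measurable
  from measurable_sets[OF this, of T] show ?thesis
    unfolding F by (simp add: vimage_def Int_def space_pair_measure conj_commute)
qed

lemma grid_set_rect:
  assumes "a \<in> sets A" "b \<in> sets B"
  shows "grid_set A B (a \<times> b)"
proof -
  have "a \<times> b = {z \<in> space A \<times> space B. (of_bool (fst z \<in> a), of_bool (snd z \<in> b)) \<in> {(1::nat, 1::nat)}}"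
    using sets.sets_into_space[OF assms(1)] sets.sets_into_space[OF assms(2)] by auto
  moreover have "(\<lambda>x. of_bool (x \<in> a) :: nat) \<in> A \<rightarrow>\<^sub>M count_space UNIV"
    "(\<lambda>x. of_bool (x \<in> b) :: nat) \<in> B \<rightarrow>\<^sub>M count_space UNIV"
    using assms by measurable
  moreover have "finite (range (\<lambda>x. of_bool (x \<in> a) :: nat))" "finite (range (\<lambda>x. of_bool (x \<in> b) :: nat))"
    by (rule finite_subset[of _ "{0,1}"]; auto simp: of_bool_def)+
  ultimately show ?thesis unfolding grid_set_def by blast
qed

lemma grid_set_compl:
  assumes "grid_set A B F"
  shows "grid_set A B (space A \<times> space B - F)"
proof -
  from assms obtain f :: "'a \<Rightarrow> nat" and g :: "'b \<Rightarrow> nat" and T where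
    f: "f \<in> A \<rightarrow>\<^sub>M count_space UNIV" "g \<in> B \<rightarrow>\<^sub>M count_space UNIV" "finite (range f)" "finite (range g)"
    and F: "F = {z \<in> space A \<times> space B. (f (fst z), g (snd z)) \<in> T}"
    unfolding grid_set_def by blast
  have "space A \<times> space B - F = {z \<in> space A \<times> space B. (f (fst z), g (snd z)) \<in> - T}"
    unfolding F by auto
  with f show ?thesis unfolding grid_set_def by blast
qed

lemma grid_set_Un:
  assumes "grid_set A B F" "grid_set A B F'"
  shows "grid_set A B (F \<union> F')"
proof -
  from assms obtain f :: "'a \<Rightarrow> nat" and g :: "'b \<Rightarrow> nat" and T where
    [measurable]: "f \<in> A \<rightarrow>\<^sub>M count_space UNIV" "g \<in> B \<rightarrow>\<^sub>M count_space UNIV"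
    and fin: "finite (range f)" "finite (range g)"
    and F: "F = {z \<in> space A \<times> space B. (f (fst z), g (snd z)) \<in> T}"
    unfolding grid_set_def by blast
  from assms obtain f' :: "'a \<Rightarrow> nat" and g' :: "'b \<Rightarrow> nat" and T' where
    [measurable]: "f' \<in> A \<rightarrow>\<^sub>M count_space UNIV" "g' \<in> B \<rightarrow>\<^sub>M count_space UNIV"
    and fin': "finite (range f')" "finite (range g')"
    and F': "F' = {z \<in> space A \<times> space B. (f' (fst z), g' (snd z)) \<in> T'}"
    unfolding grid_set_def by blast
  let ?f = "\<lambda>x. prod_encode (f x, f' x)" and ?g = "\<lambda>x. prod_encode (g x, g' x)"
  let ?T = "{(u, v). (fst (prod_decode u), fst (prod_decode v)) \<in> T \<or> (snd (prod_decode u), snd (prod_decode v)) \<in> T'}"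
  have "F \<union> F' = {z \<in> space A \<times> space B. (?f (fst z), ?g (snd z)) \<in> ?T}"
    unfolding F F' by auto
  moreover have "?f \<in> A \<rightarrow>\<^sub>M count_space UNIV" "?g \<in> B \<rightarrow>\<^sub>M count_space UNIV" by measurable
  moreover have "finite (range ?f)"
    by (rule finite_subset[OF _ finite_imageI[OF finite_cartesian_product[OF fin(1) fin'(1)], of prod_encode]]) auto
  moreover have "finite (range ?g)"
    by (rule finite_subset[OF _ finite_imageI[OF finite_cartesian_product[OF fin(2) fin'(2)], of prod_encode]]) auto
  ultimately show ?thesis unfolding grid_set_def by blast
qed

lemma finite_measure_sym_diff_triangle:
  assumes "finite_measure m" "E \<in> sets m" "F \<in> sets m" "G \<in> sets m"
  shows "measure m (sym_diff E G) \<le> measure m (sym_diff E F) + measure m (sym_diff F G)"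
proof -
  interpret finite_measure m by fact
  have "measure m (sym_diff E G) \<le> measure m (sym_diff E F \<union> sym_diff F G)"
    using assms by (intro finite_measure_mono) auto
  also have "\<dots> \<le> measure m (sym_diff E F) + measure m (sym_diff F G)"
    using assms by (intro measure_Un_le) auto
  finally show ?thesis .
qed

lemma finite_measure_sym_diff_Un:
  assumes "finite_measure m" "E \<in> sets m" "F \<in> sets m" "E' \<in> sets m" "F' \<in> sets m"
  shows "measure m (sym_diff (E \<union> E') (F \<union> F')) \<le> measure m (sym_diff E F) + measure m (sym_diff E' F')"
proof -
  interpret finite_measure m by fact
  have "measure m (sym_diff (E \<union> E') (F \<union> F')) \<le> measure m (sym_diff E F \<union> sym_diff E' F')"
    using assms by (intro finite_measure_mono) auto
  also have "\<dots> \<le> measure m (sym_diff E F) + measure m (sym_diff E' F')"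
    using assms by (intro measure_Un_le) auto
  finally show ?thesis .
qed

text \<open>One \<open>F\<close> must serve both measures, because the diagonal law and the product
  law are approximated at once. The sets with this property contain the rectangles and are closed
  under complements, which leave symmetric differences unchanged, and under countable disjoint
  unions: finite initial unions inherit the property and exhaust the whole union in both
  measures.\<close>

lemma grid_set_approx:
  fixes m1 m2 :: "('a \<times> 'b) measure"
  assumes fm: "finite_measure m1" "finite_measure m2"
    and s1: "sets m1 = sets (A \<Otimes>\<^sub>M B)" and s2: "sets m2 = sets (A \<Otimes>\<^sub>M B)"
    and E: "E \<in> sets (A \<Otimes>\<^sub>M B)"
  shows "\<forall>\<epsilon>>0. \<exists>F. grid_set A B F \<and> measure m1 (sym_diff E F) + measure m2 (sym_diff E F) < \<epsilon>"
proof -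
  interpret m1: finite_measure m1 by fact
  interpret m2: finite_measure m2 by fact
  note sets = grid_set_sets[of A B] s1 s2
  let ?R = "{a \<times> b |a b. a \<in> sets A \<and> b \<in> sets B}"
  let ?d = "\<lambda>E F. measure m1 (sym_diff E F) + measure m2 (sym_diff E F)"
  have tri: "?d E G \<le> ?d E F + ?d F G" if "E \<in> sets m1" "F \<in> sets m1" "G \<in> sets m1" for E F G
    using finite_measure_sym_diff_triangle[OF fm(1), of E F G]
      finite_measure_sym_diff_triangle[OF fm(2), of E F G] that s1 s2 by auto
  have un: "?d (E \<union> E') (F \<union> F') \<le> ?d E F + ?d E' F'"
    if "E \<in> sets m1" "F \<in> sets m1" "E' \<in> sets m1" "F' \<in> sets m1" for E F E' F'
    using finite_measure_sym_diff_Un[OF fm(1), of E F E' F']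
      finite_measure_sym_diff_Un[OF fm(2), of E F E' F'] that s1 s2 by auto
  have "Int_stable ?R"
    by (rule Int_stable_pair_measure_generator)
  moreover have "?R \<subseteq> Pow (space A \<times> space B)"
    by (auto dest: sets.sets_into_space)
  moreover have E': "E \<in> sigma_sets (space A \<times> space B) ?R"
    using E by (simp add: sets_pair_measure)
  ultimately show ?thesis
  proof (induction rule: sigma_sets_induct_disjoint)
    case (basic A')
    then have "grid_set A B A'" using grid_set_rect by blast
    then show ?case by (intro allI impI exI[of _ A']) auto
  next
    case empty
    have "grid_set A B {}" using grid_set_rect[of "{}" A "{}" B] by simp
    then show ?case by (intro allI impI exI[of _ "{}"]) auto
  next
    case (compl C)
    have C: "C \<in> sets m1" using compl(1) s1 by (simp add: sets_pair_measure)
    show ?case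
    proof (intro allI impI)
      fix \<epsilon> :: real assume "\<epsilon> > 0"
      with compl(2) obtain F where F: "grid_set A B F" "?d C F < \<epsilon>" by blast
      have "C \<subseteq> space A \<times> space B" "F \<subseteq> space A \<times> space B"
        using sets.sets_into_space[OF C] sets_eq_imp_space_eq[OF s1]
          sets.sets_into_space[OF grid_set_sets[OF F(1)]] by (auto simp: space_pair_measure)
      then have "sym_diff (space A \<times> space B - C) (space A \<times> space B - F) = sym_diff C F" by auto
      then show "\<exists>F. grid_set A B F \<and> ?d (space A \<times> space B - C) F < \<epsilon>"
        using F grid_set_compl[OF F(1)] by (intro exI[of _ "space A \<times> space B - F"]) auto
    qed
  next
    case (union C)
    have C: "C i \<in> sets m1" for i using union(2) s1 by (auto simp: sets_pair_measure)
    let ?D = "\<lambda>n. \<Union>i<n. C i"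
    have D: "?D n \<in> sets m1" for n using C by auto
    have DD: "(\<Union>i. C i) \<in> sets m1" using C by auto
    have ap: "\<forall>\<epsilon>>0. \<exists>F. grid_set A B F \<and> ?d (?D n) F < \<epsilon>" for n
    proof (induction n)
      case 0
      have "grid_set A B {}" using grid_set_rect[of "{}" A "{}" B] by simp
      then show ?case by (intro allI impI exI[of _ "{}"]) auto
    next
      case (Suc n)
      show ?case
      proof (intro allI impI)
        fix \<epsilon> :: real assume "\<epsilon> > 0"
        then have "\<epsilon> / 2 > 0" by simp
        with Suc obtain F where F: "grid_set A B F" "?d (?D n) F < \<epsilon> / 2" by blast
        from \<open>\<epsilon> / 2 > 0\<close> union(3) obtain F' where F': "grid_set A B F'" "?d (C n) F' < \<epsilon> / 2" by blast
        have "?d (?D (Suc n)) (F \<union> F') < \<epsilon>"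
          using un[of "?D n" F "C n" F'] F F' D[of n] C[of n] sets by (auto simp: lessThan_Suc Un_commute)
        then show "\<exists>F. grid_set A B F \<and> ?d (?D (Suc n)) F < \<epsilon>"
          using grid_set_Un[OF F(1) F'(1)] by blast
      qed
    qed
    have lim: "(\<lambda>n. ?d (\<Union>i. C i) (?D n)) \<longlonglongrightarrow> 0"
    proof -
      have Deq: "(\<Union>n. ?D n) = (\<Union>i. C i)" by auto
      have inc: "incseq ?D" by (rule monoI) (rule UN_mono, auto)
      have "(\<lambda>n. measure m (?D n)) \<longlonglongrightarrow> measure m (\<Union>n. ?D n)"
        if "finite_measure m" "sets m = sets m1" for m
        by (rule finite_measure.finite_Lim_measure_incseq[OF that(1) _ inc]) (use D that(2) in auto)
      note l = this[OF fm(1) refl] this[OF fm(2)]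
      have "?d (\<Union>i. C i) (?D n) = (measure m1 (\<Union>i. C i) - measure m1 (?D n)) + (measure m2 (\<Union>i. C i) - measure m2 (?D n))" for n
      proof -
        have sd: "sym_diff (\<Union>i. C i) (?D n) = (\<Union>i. C i) - ?D n" by auto
        show ?thesis unfolding sd
          using D[of n] DD s1 s2
          by (subst m1.finite_measure_Diff, auto)(subst m2.finite_measure_Diff, auto)
      qed
      moreover have "(\<lambda>n. (measure m1 (\<Union>i. C i) - measure m1 (?D n)) + (measure m2 (\<Union>i. C i) - measure m2 (?D n))) \<longlonglongrightarrow> (measure m1 (\<Union>i. C i) - measure m1 (\<Union>i. C i)) + (measure m2 (\<Union>i. C i) - measure m2 (\<Union>i. C i))"
        using l s1 s2 unfolding Deq by (intro tendsto_intros) auto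
      ultimately show ?thesis by simp
    qed
    show ?case
    proof (intro allI impI)
      fix \<epsilon> :: real assume "\<epsilon> > 0"
      then have e2: "\<epsilon> / 2 > 0" by simp
      from order_tendstoD(2)[OF lim e2] obtain n where n: "?d (\<Union>i. C i) (?D n) < \<epsilon> / 2"
        by (auto simp: eventually_sequentially)
      from ap[of n] e2 obtain F where F: "grid_set A B F" "?d (?D n) F < \<epsilon> / 2" by blast
      have "?d (\<Union>i. C i) F < \<epsilon>"
        using tri[OF DD D[of n], of F] n F sets by auto
      then show "\<exists>F. grid_set A B F \<and> ?d (\<Union>i. C i) F < \<epsilon>" using F by blast
    qed
  qed
qed


section \<open>From partition sums to arbitrary events of the product \<sigma>-algebra\<close>

lemma beta_alg_sum_le_2:
  assumes "prob_space M" "sets A \<subseteq> sets M" "sets B \<subseteq> sets M"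
    and P: "finite P" "partition_on (space M) P" "P \<subseteq> sets A"
    and Q: "finite Q" "partition_on (space M) Q" "Q \<subseteq> sets B"
  shows "(\<Sum>a\<in>P. \<Sum>b\<in>Q. \<bar>measure M (a \<inter> b) - measure M a * measure M b\<bar>) \<le> 2"
proof -
  interpret prob_space M by fact
  have pm: "(\<Sum>a\<in>R. measure M (a \<inter> c)) = measure M c"
    if "finite R" "partition_on (space M) R" "R \<subseteq> sets M" "c \<in> sets M" for R c
  proof -
    have "disjoint_family_on (\<lambda>a. a \<inter> c) R"
      using partition_onD2[OF that(2)] unfolding disjoint_family_on_def disjoint_def by blast
    then have "(\<Sum>a\<in>R. measure M (a \<inter> c)) = measure M (\<Union>a\<in>R. a \<inter> c)"
      using that by (intro finite_measure_finite_Union[symmetric]) auto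
    also have "(\<Union>a\<in>R. a \<inter> c) = c"
      using partition_onD1[OF that(2)] sets.sets_into_space[OF that(4)] by auto
    finally show ?thesis .
  qed
  have PM: "P \<subseteq> sets M" and QM: "Q \<subseteq> sets M" using assms by auto
  have p1: "(\<Sum>a\<in>P. measure M a) = 1"
    using pm[OF P(1,2) PM, of "space M"] PM sets.Int_space_eq2 by (simp add: prob_space subset_iff cong: sum.cong)
  have q1: "(\<Sum>a\<in>Q. measure M a) = 1"
    using pm[OF Q(1,2) QM, of "space M"] QM sets.Int_space_eq2 by (simp add: prob_space subset_iff cong: sum.cong)
  have "(\<Sum>a\<in>P. \<Sum>b\<in>Q. \<bar>measure M (a \<inter> b) - measure M a * measure M b\<bar>)
     \<le> (\<Sum>a\<in>P. \<Sum>b\<in>Q. measure M (a \<inter> b) + measure M a * measure M b)"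
    by (intro sum_mono) (smt (verit) measure_nonneg mult_nonneg_nonneg)
  also have "\<dots> = (\<Sum>b\<in>Q. \<Sum>a\<in>P. measure M (a \<inter> b)) + (\<Sum>a\<in>P. measure M a) * (\<Sum>b\<in>Q. measure M b)"
    by (simp add: sum.distrib sum_product sum.swap[of _ P Q])
  also have "(\<Sum>b\<in>Q. \<Sum>a\<in>P. measure M (a \<inter> b)) = (\<Sum>b\<in>Q. measure M b)"
    using QM by (intro sum.cong refl pm P PM) auto
  finally show ?thesis using p1 q1 by simp
qed

text \<open>The bound by 2 is what gives \<open>Sup\<close> a meaning here: a supremum of reals
  dominates its members only if the set is bounded above.\<close>

lemma beta_alg_upper:
  assumes "prob_space M" "sets A \<subseteq> sets M" "sets B \<subseteq> sets M"
    and P: "finite P" "partition_on (space M) P" "P \<subseteq> sets A"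
    and Q: "finite Q" "partition_on (space M) Q" "Q \<subseteq> sets B"
  shows "(\<Sum>a\<in>P. \<Sum>b\<in>Q. \<bar>measure M (a \<inter> b) - measure M a * measure M b\<bar>) \<le> 2 * beta_alg M A B"
proof -
  let ?S = "{\<Sum>a\<in>P. \<Sum>b\<in>Q. \<bar>measure M (a \<inter> b) - measure M a * measure M b\<bar> | P Q.
       finite P \<and> partition_on (space M) P \<and> P \<subseteq> sets A \<and>
       finite Q \<and> partition_on (space M) Q \<and> Q \<subseteq> sets B}"
  have "bdd_above ?S"
    by (rule bdd_aboveI[of _ 2]) (use beta_alg_sum_le_2[OF assms(1-3)] in blast)
  then have "(\<Sum>a\<in>P. \<Sum>b\<in>Q. \<bar>measure M (a \<inter> b) - measure M a * measure M b\<bar>) \<le> Sup ?S"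
    using P Q by (intro cSup_upper) blast
  then show ?thesis unfolding beta_alg_def by simp
qed

text \<open>Needed to bound the family under the outer supremum of \<open>beta_mix\<close>. The
  trivial partition makes the inner set nonempty.\<close>

lemma beta_alg_le_1:
  assumes "prob_space M" "sets A \<subseteq> sets M" "sets B \<subseteq> sets M"
    and "space M \<in> sets A" "space M \<in> sets B"
  shows "beta_alg M A B \<le> 1"
proof -
  interpret prob_space M by fact
  let ?S = "{\<Sum>a\<in>P. \<Sum>b\<in>Q. \<bar>measure M (a \<inter> b) - measure M a * measure M b\<bar> | P Q.
       finite P \<and> partition_on (space M) P \<and> P \<subseteq> sets A \<and>
       finite Q \<and> partition_on (space M) Q \<and> Q \<subseteq> sets B}"
  have "partition_on (space M) {space M}" using not_empty by (rule partition_on_space)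
  then have "?S \<noteq> {}" using assms(4,5)
    by (auto intro!: exI[of _ "{space M}"])
  then have "Sup ?S \<le> 2"
    by (rule cSup_least) (use beta_alg_sum_le_2[OF assms(1-3)] in blast)
  then show ?thesis unfolding beta_alg_def by simp
qed

text \<open>The fibres of the two labels are finite partitions, and both probabilities are sums over
  the cells selected by \<open>T\<close>. Absolute values allow enlarging the sum to all cells,
  where it is at most twice the coefficient.\<close>

lemma beta_alg_grid:
  assumes M: "prob_space M" and A: "space A = space M" "sets A \<subseteq> sets M"
    and B: "space B = space M" "sets B \<subseteq> sets M"
    and F: "grid_set A B F"
  shows "\<bar>measure M {\<omega>\<in>space M. (\<omega>, \<omega>) \<in> F} - measure (M \<Otimes>\<^sub>M M) F\<bar> \<le> 2 * beta_alg M A B"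
proof -
  interpret prob_space M by fact
  interpret MM: pair_prob_space M M ..
  from F obtain f :: "'a \<Rightarrow> nat" and g :: "'a \<Rightarrow> nat" and T where
    f: "f \<in> A \<rightarrow>\<^sub>M count_space UNIV" and g: "g \<in> B \<rightarrow>\<^sub>M count_space UNIV"
    and fin: "finite (range f)" "finite (range g)"
    and F: "F = {z \<in> space M \<times> space M. (f (fst z), g (snd z)) \<in> T}"
    unfolding grid_set_def A B by blast
  \<comment> \<open>Only labels attained on \<open>space M\<close> are kept:
    \<open>partition_on\<close> forbids empty cells, and injectivity of the fibre maps needs
    nonempty ones.\<close>
  define U where "U = f ` space M"
  define V where "V = g ` space M"
  have UV: "finite U" "finite V"
    using finite_subset[OF _ fin(1), of U] finite_subset[OF _ fin(2), of V] by (auto simp: U_def V_def)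
  define a where "a u = f -` {u} \<inter> space M" for u
  define b where "b v = g -` {v} \<inter> space M" for v
  have aA: "a u \<in> sets A" for u
    using measurable_sets[OF f, of "{u}"] by (simp add: a_def A)
  have bB: "b u \<in> sets B" for u
    using measurable_sets[OF g, of "{u}"] by (simp add: b_def B)
  have [measurable]: "a u \<in> sets M" "b u \<in> sets M" for u using aA bB A B by auto
  have part: "partition_on (space M) (a ` U)" "partition_on (space M) (b ` V)"
    by (auto simp: partition_on_def disjoint_def a_def b_def U_def V_def)
  have inj: "inj_on a U" "inj_on b V"
    by (auto simp: inj_on_def a_def b_def U_def V_def)
  have disj: "disjoint_family_on (\<lambda>p. a (fst p) \<inter> b (snd p)) (T \<inter> (U \<times> V))"
    by (auto simp: disjoint_family_on_def a_def b_def)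
  have "{\<omega>\<in>space M. (\<omega>, \<omega>) \<in> F} = (\<Union>p\<in>T \<inter> (U \<times> V). a (fst p) \<inter> b (snd p))"
    unfolding F by (auto simp: a_def b_def U_def V_def)
  also have "measure M \<dots> = (\<Sum>p\<in>T \<inter> (U \<times> V). measure M (a (fst p) \<inter> b (snd p)))"
    using UV disj by (intro finite_measure_finite_Union) auto
  finally have m1: "measure M {\<omega>\<in>space M. (\<omega>, \<omega>) \<in> F} = \<dots>" .
  have disj: "disjoint_family_on (\<lambda>p. a (fst p) \<times> b (snd p)) (T \<inter> (U \<times> V))"
    by (auto simp: disjoint_family_on_def a_def b_def)
  have "F = (\<Union>p\<in>T \<inter> (U \<times> V). a (fst p) \<times> b (snd p))"
    unfolding F by (auto simp: a_def b_def U_def V_def)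
  also have "measure (M \<Otimes>\<^sub>M M) \<dots> = (\<Sum>p\<in>T \<inter> (U \<times> V). measure (M \<Otimes>\<^sub>M M) (a (fst p) \<times> b (snd p)))"
    using UV disj by (intro MM.finite_measure_finite_Union) auto
  also have "\<dots> = (\<Sum>p\<in>T \<inter> (U \<times> V). measure M (a (fst p)) * measure M (b (snd p)))"
    by (intro sum.cong refl) (simp add: measure_def emeasure_pair_measure_Times enn2real_mult)
  finally have m2: "measure (M \<Otimes>\<^sub>M M) F = \<dots>" .
  have "\<bar>measure M {\<omega>\<in>space M. (\<omega>, \<omega>) \<in> F} - measure (M \<Otimes>\<^sub>M M) F\<bar>
    \<le> (\<Sum>p\<in>T \<inter> (U \<times> V). \<bar>measure M (a (fst p) \<inter> b (snd p)) - measure M (a (fst p)) * measure M (b (snd p))\<bar>)"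
    unfolding m1 m2 sum_subtractf[symmetric] by (rule sum_abs)
  also have "\<dots> \<le> (\<Sum>p\<in>U \<times> V. \<bar>measure M (a (fst p) \<inter> b (snd p)) - measure M (a (fst p)) * measure M (b (snd p))\<bar>)"
    using UV by (intro sum_mono2) auto
  also have "\<dots> = (\<Sum>u\<in>U. \<Sum>v\<in>V. \<bar>measure M (a u \<inter> b v) - measure M (a u) * measure M (b v)\<bar>)"
    by (simp add: sum.cartesian_product case_prod_beta)
  also have "\<dots> = (\<Sum>a\<in>a`U. \<Sum>b\<in>b`V. \<bar>measure M (a \<inter> b) - measure M a * measure M b\<bar>)"
    using inj by (simp add: sum.reindex)
  also have "\<dots> \<le> 2 * beta_alg M A B"
    by (rule beta_alg_upper[OF M A(2) B(2)]) (use UV part aA bB in auto)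
  finally show ?thesis .
qed

text \<open>All later use of mixing passes through this estimate. A grid that is close to
  \<open>E\<close> under the diagonal law and the product law simultaneously reduces it to
  \<open>beta_alg_grid\<close>.\<close>

lemma beta_alg_total_variation:
  assumes M: "prob_space M" and A: "space A = space M" "sets A \<subseteq> sets M"
    and B: "space B = space M" "sets B \<subseteq> sets M"
    and E: "E \<in> sets (A \<Otimes>\<^sub>M B)"
  shows "\<bar>measure M {\<omega>\<in>space M. (\<omega>, \<omega>) \<in> E} - measure (M \<Otimes>\<^sub>M M) E\<bar> \<le> 2 * beta_alg M A B"
proof (rule field_le_epsilon)
  fix \<epsilon> :: real assume "\<epsilon> > 0"
  interpret prob_space M by fact
  interpret MM: pair_prob_space M M ..
  have [measurable]: "(\<lambda>x. x) \<in> M \<rightarrow>\<^sub>M A" "(\<lambda>x. x) \<in> M \<rightarrow>\<^sub>M B"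
    using A B by (auto simp: measurable_def sets.sets_into_space inf.absorb1 subset_iff)
  have [measurable]: "(\<lambda>x. (x, x)) \<in> M \<rightarrow>\<^sub>M A \<Otimes>\<^sub>M B" by measurable
  have [measurable]: "(\<lambda>x. x) \<in> M \<Otimes>\<^sub>M M \<rightarrow>\<^sub>M A \<Otimes>\<^sub>M B"
    by (subst measurable_pair_iff) (auto simp: comp_def)
  \<comment> \<open>The laws of (\<omega>, \<omega>) and of an independent pair, both restricted to
    the product of the sub-\<sigma>-algebras.\<close>
  let ?m1 = "distr M (A \<Otimes>\<^sub>M B) (\<lambda>x. (x, x))" and ?m2 = "distr (M \<Otimes>\<^sub>M M) (A \<Otimes>\<^sub>M B) (\<lambda>x. x)"
  interpret m1: prob_space ?m1 by (rule prob_space_distr) simp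
  interpret m2: prob_space ?m2 by (rule MM.prob_space_distr) simp
  have v1: "measure ?m1 F = measure M {\<omega>\<in>space M. (\<omega>, \<omega>) \<in> F}" if "F \<in> sets (A \<Otimes>\<^sub>M B)" for F
    using that by (subst measure_distr) (auto intro!: arg_cong[of _ _ "measure M"])
  have v2: "measure ?m2 F = measure (M \<Otimes>\<^sub>M M) F" if "F \<in> sets (A \<Otimes>\<^sub>M B)" for F
    using that sets.sets_into_space[OF that]
    by (subst measure_distr) (auto intro!: arg_cong[of _ _ "measure (M \<Otimes>\<^sub>M M)"] simp: space_pair_measure A B)
  obtain F where F: "grid_set A B F" "measure ?m1 (sym_diff E F) + measure ?m2 (sym_diff E F) < \<epsilon>"
    using grid_set_approx[OF m1.finite_measure_axioms m2.finite_measure_axioms _ _ E] \<open>\<epsilon> > 0\<close> by auto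
  note FS = grid_set_sets[OF F(1)]
  have d: "\<bar>measure m E - measure m F\<bar> \<le> measure m (sym_diff E F)"
    if m: "finite_measure m" "sets m = sets (A \<Otimes>\<^sub>M B)" for m
  proof -
    interpret finite_measure m by fact
    have "measure m E \<le> measure m (F \<union> sym_diff E F)" "measure m F \<le> measure m (E \<union> sym_diff E F)"
      using E FS m by (auto intro!: finite_measure_mono)
    moreover have "measure m (F \<union> sym_diff E F) \<le> measure m F + measure m (sym_diff E F)"
      "measure m (E \<union> sym_diff E F) \<le> measure m E + measure m (sym_diff E F)"
      using E FS m by (auto intro!: measure_Un_le)
    ultimately show ?thesis by linarith
  qed
  have "\<bar>measure ?m1 E - measure ?m2 E\<bar> \<le> 2 * beta_alg M A B + \<epsilon>"
    using d[OF m1.finite_measure_axioms] d[OF m2.finite_measure_axioms] F(2)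
      beta_alg_grid[OF M A B F(1)] FS by (simp add: v1 v2)
  then show "\<bar>measure M {\<omega>\<in>space M. (\<omega>, \<omega>) \<in> E} - measure (M \<Otimes>\<^sub>M M) E\<bar> \<le> 2 * beta_alg M A B + \<epsilon>"
    using E by (simp add: v1 v2)
qed

section \<open>Comparison with independent blocks\<close>

text \<open>A pointwise bound settles every case, since a function that is not integrable has
  integral 0 by convention, and \<open>c\<close> is nonnegative because a probability space is
  nonempty.\<close>

lemma (in prob_space) abs_expectation_le:
  fixes f :: "'a \<Rightarrow> real"
  assumes "\<And>x. x \<in> space M \<Longrightarrow> \<bar>f x\<bar> \<le> c"
  shows "\<bar>expectation f\<bar> \<le> c"
proof -
  have "0 \<le> c" using not_empty assms by fastforce
  have "\<bar>expectation f\<bar> \<le> (\<integral>x. \<bar>f x\<bar> \<partial>M)" by (rule integral_abs_bound)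
  also have "\<dots> \<le> (\<integral>x. c \<partial>M)"
    using assms \<open>0 \<le> c\<close> by (intro integral_mono') auto
  finally show ?thesis by (simp add: prob_space)
qed

lemma measurable_gen_sigma:
  assumes "i \<in> I" "\<And>i. X i \<in> M \<rightarrow>\<^sub>M borel"
  shows "X i \<in> gen_sigma M X I \<rightarrow>\<^sub>M borel"
proof (rule measurableI)
  fix B assume "B \<in> sets (borel :: 'b measure)"
  then show "X i -` B \<inter> space (gen_sigma M X I) \<in> sets (gen_sigma M X I)"
    using assms(1) unfolding gen_sigma_def by (simp add: space_measure_of_conv) (intro in_measure_of; blast)
qed simp

lemma space_gen_sigma [simp]: "space (gen_sigma M X I) = space M"
  unfolding gen_sigma_def by (simp add: space_measure_of_conv)

lemma sets_gen_sigma_subset: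
  assumes "\<And>i. X i \<in> M \<rightarrow>\<^sub>M borel"
  shows "sets (gen_sigma M X I) \<subseteq> sets M"
proof -
  have "{X i -` B \<inter> space M | i B. i \<in> I \<and> B \<in> sets borel} \<subseteq> sets M"
    using assms by (auto intro: measurable_sets)
  then show ?thesis unfolding gen_sigma_def
    by (subst sets_measure_of) (auto intro!: sets.sigma_sets_subset)
qed

lemma beta_alg_le_beta_mix:
  assumes "prob_space M" "\<And>i. X i \<in> M \<rightarrow>\<^sub>M borel" "l \<ge> 1"
  shows "beta_alg M (gen_sigma M X {1..l}) (gen_sigma M X {l + int k..}) \<le> beta_mix M X k"
  unfolding beta_mix_def
proof (rule cSUP_upper)
  have "space M \<in> sets (gen_sigma M X I)" for I
    using sets.top[of "gen_sigma M X I"] by simp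
  then show "bdd_above ((\<lambda>l. beta_alg M (gen_sigma M X {1..l}) (gen_sigma M X {l + int k..})) ` {1..})"
    using assms by (intro bdd_aboveI[of _ 1]) (auto intro!: beta_alg_le_1 dest: subsetD[OF sets_gen_sigma_subset, rotated])
qed (use assms in auto)

text \<open>
  The process \<open>\<lambda>i. X i (\<omega> (max (b i) t))\<close> on the product space interpolates between independent
  blocks (\<open>t = 0\<close>) and the original process (\<open>t = m\<close>).
\<close>

lemma block_merge_step:
  fixes X :: "int \<Rightarrow> 'w \<Rightarrow> 's::topological_space" and b :: "int \<Rightarrow> nat"
  assumes M: "prob_space M" and X[measurable]: "\<And>i. X i \<in> M \<rightarrow>\<^sub>M borel"
    and b: "\<And>i. i \<in> J \<Longrightarrow> 1 \<le> i \<and> b i \<le> m" and t: "t < m"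
    and l: "l \<ge> 1" "\<And>i. i \<in> J \<Longrightarrow> b i \<le> t \<Longrightarrow> i \<le> l"
      "\<And>i. i \<in> J \<Longrightarrow> b i = Suc t \<Longrightarrow> l + int L \<le> i"
    and E[measurable]: "E \<in> sets (PiM J (\<lambda>_. borel))"
  defines "Q \<equiv> PiM {..m} (\<lambda>_. M)"
    and "W \<equiv> \<lambda>t \<omega>. (\<lambda>i\<in>J. X i (\<omega> (max (b i) t)))"
  shows "\<bar>measure Q {\<omega>\<in>space Q. W (Suc t) \<omega> \<in> E} - measure Q {\<omega>\<in>space Q. W t \<omega> \<in> E}\<bar>
    \<le> 2 * beta_mix M X L"
proof -
  interpret prob_space M by fact
  interpret MM: pair_prob_space M M ..
  interpret P: product_prob_space "\<lambda>_::nat. M" UNIV ..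
  define I where "I = {..m} - {t, Suc t}"
  interpret QI: prob_space "PiM I (\<lambda>_. M)" by (rule prob_space_PiM) (rule M)
  interpret Q: prob_space Q unfolding Q_def by (rule prob_space_PiM) (rule M)
  have I: "finite I" "t \<notin> I" "Suc t \<notin> insert t I" "{..m} = insert (Suc t) (insert t I)"
    using t by (auto simp: I_def)
  have W[measurable]: "W s \<in> Q \<rightarrow>\<^sub>M PiM J (\<lambda>_. borel)" if "s \<le> m" for s
    unfolding W_def Q_def
  proof (rule measurable_restrict)
    fix i assume "i \<in> J"
    then have "max (b i) s \<in> {..m}" using b that by auto
    then show "(\<lambda>\<omega>. X i (\<omega> (max (b i) s))) \<in> PiM {..m} (\<lambda>_. M) \<rightarrow>\<^sub>M borel" by measurable
  qed
  \<comment> \<open>With all coordinates except \<open>t\<close> and \<open>Suc t\<close> frozen,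
    stage \<open>t\<close> evaluates this configuration at (x, y) and stage \<open>Suc t\<close> at
    (y, y). The two stages thus differ exactly by product law against diagonal law.\<close>
  define Z where "Z \<omega> x y = (\<lambda>i\<in>J. if b i \<le> t then X i x else if b i = Suc t then X i y else X i (\<omega> (b i)))"
    for \<omega> x y
  let ?f = "\<lambda>s \<omega> x y. indicat_real E (W s ((\<omega>)(t := x, Suc t := y)))"
  have f: "(\<lambda>z. ?f s (fst (fst z)) (snd (fst z)) (snd z)) \<in> borel_measurable ((PiM I (\<lambda>_. M) \<Otimes>\<^sub>M M) \<Otimes>\<^sub>M M)" if "s \<le> m" for s
  proof -
    have "(\<lambda>z. (fst (fst z))(t := snd (fst z), Suc t := snd z)) \<in> (PiM I (\<lambda>_. M) \<Otimes>\<^sub>M M) \<Otimes>\<^sub>M M \<rightarrow>\<^sub>M Q"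
      unfolding Q_def I(4)
      by (rule measurable_fun_upd[where J="insert t I"], simp, rule measurable_fun_upd[where J=I]) auto
    then show ?thesis
      by (intro measurable_compose[OF measurable_compose[OF _ W[OF that]] borel_measurable_indicator[OF E]])
  qed
  have g: "(\<lambda>z. \<integral>y. ?f s (fst z) (snd z) y \<partial>M) \<in> borel_measurable (PiM I (\<lambda>_. M) \<Otimes>\<^sub>M M)" if "s \<le> m" for s
    by (rule borel_measurable_lebesgue_integral) (use f[OF that] in \<open>simp add: case_prod_beta\<close>)
  have k: "(\<lambda>\<omega>. \<integral>x. \<integral>y. ?f s \<omega> x y \<partial>M \<partial>M) \<in> borel_measurable (PiM I (\<lambda>_. M))" if "s \<le> m" for s
    by (rule borel_measurable_lebesgue_integral) (use g[OF that] in \<open>simp add: case_prod_beta\<close>)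
  have b1: "\<bar>\<integral>y. ?f s \<omega> x y \<partial>M\<bar> \<le> 1" for s \<omega> x
    by (rule abs_expectation_le) simp
  have b2: "\<bar>\<integral>x. \<integral>y. ?f s \<omega> x y \<partial>M \<partial>M\<bar> \<le> 1" for s \<omega>
    by (rule abs_expectation_le) (rule b1)
  have int: "integrable (PiM I (\<lambda>_. M)) (\<lambda>\<omega>. \<integral>x. \<integral>y. ?f s \<omega> x y \<partial>M \<partial>M)" if "s \<le> m" for s
    by (rule QI.integrable_const_bound[where B=1]) (use b2 k[OF that] in auto)
  \<comment> \<open>Fubini: coordinates \<open>Suc t\<close> and \<open>t\<close> are integrated
    first, so that the remaining ones become a parameter and the comparison can be made for each
    value of it.\<close>
  have H: "measure Q {\<omega>\<in>space Q. W s \<omega> \<in> E} = (\<integral>\<omega>. \<integral>x. \<integral>y. ?f s \<omega> x y \<partial>M \<partial>M \<partial>PiM I (\<lambda>_. M))"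
    if s: "s \<le> m" for s
  proof -
    have ind: "(\<lambda>\<omega>. indicat_real E (W s \<omega>)) \<in> borel_measurable Q"
      using W[OF s] by measurable
    have intQ: "integrable Q (\<lambda>\<omega>. indicat_real E (W s \<omega>))"
      by (rule Q.integrable_const_bound[where B=1]) (use ind in auto)
    have "measure Q {\<omega>\<in>space Q. W s \<omega> \<in> E} = (\<integral>\<omega>. indicat_real E (W s \<omega>) \<partial>Q)"
    proof -
      have "(\<integral>\<omega>. indicat_real E (W s \<omega>) \<partial>Q) = (\<integral>\<omega>. indicat_real {\<omega>\<in>space Q. W s \<omega> \<in> E} \<omega> \<partial>Q)"
        by (intro Bochner_Integration.integral_cong) (auto simp: indicator_def)
      also have "\<dots> = measure Q {\<omega>\<in>space Q. W s \<omega> \<in> E}"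
        by (subst Bochner_Integration.integral_indicator) (auto simp: Int_def intro!: arg_cong[of _ _ "measure Q"])
      finally show ?thesis by simp
    qed
    also have "\<dots> = (\<integral>\<omega>. \<integral>y. indicat_real E (W s ((\<omega>)(Suc t := y))) \<partial>M \<partial>PiM (insert t I) (\<lambda>_. M))"
      unfolding Q_def I(4)
      by (rule P.product_integral_insert[OF _ I(3) intQ[unfolded Q_def I(4)]]) (use I(1) in simp)
    also have "\<dots> = (\<integral>\<omega>. \<integral>x. \<integral>y. ?f s \<omega> x y \<partial>M \<partial>M \<partial>PiM I (\<lambda>_. M))"
    proof (rule P.product_integral_insert)
      interpret QI': prob_space "PiM (insert t I) (\<lambda>_. M)" by (rule prob_space_PiM) (rule M)
      have "(\<lambda>z. (fst z)(Suc t := snd z)) \<in> PiM (insert t I) (\<lambda>_. M) \<Otimes>\<^sub>M M \<rightarrow>\<^sub>M Q"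
        unfolding Q_def I(4) by (rule measurable_fun_upd[where J="insert t I"]) auto
      from measurable_compose[OF this ind]
      have "(\<lambda>(\<omega>, y). indicat_real E (W s ((\<omega>)(Suc t := y)))) \<in> borel_measurable (PiM (insert t I) (\<lambda>_. M) \<Otimes>\<^sub>M M)"
        by (simp add: case_prod_beta)
      then have "(\<lambda>\<omega>. \<integral>y. indicat_real E (W s ((\<omega>)(Suc t := y))) \<partial>M) \<in> borel_measurable (PiM (insert t I) (\<lambda>_. M))"
        by (rule borel_measurable_lebesgue_integral)
      moreover have "\<bar>\<integral>y. indicat_real E (W s ((\<omega>)(Suc t := y))) \<partial>M\<bar> \<le> 1" for \<omega>
        by (rule abs_expectation_le) simp
      ultimately show "integrable (PiM (insert t I) (\<lambda>_. M)) (\<lambda>\<omega>. \<integral>y. indicat_real E (W s ((\<omega>)(Suc t := y))) \<partial>M)"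
        by (intro QI'.integrable_const_bound[where B=1]) auto
    qed (use I in auto)
    finally show ?thesis .
  qed
  let ?A = "gen_sigma M X {1..l}" and ?B = "gen_sigma M X {l + int L..}"
  have pw: "\<bar>(\<integral>x. \<integral>y. ?f (Suc t) \<omega> x y \<partial>M \<partial>M) - (\<integral>x. \<integral>y. ?f t \<omega> x y \<partial>M \<partial>M)\<bar> \<le> 2 * beta_mix M X L"
    if \<omega>: "\<omega> \<in> space (PiM I (\<lambda>_. M))" for \<omega>
  proof -
    have W1: "W (Suc t) ((\<omega>)(t := x, Suc t := y)) = Z \<omega> y y" for x y
      unfolding W_def Z_def by (intro restrict_ext) (auto simp: max_def)
    have W0: "W t ((\<omega>)(t := x, Suc t := y)) = Z \<omega> x y" for x y
      unfolding W_def Z_def by (intro restrict_ext) (auto simp: max_def)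
    define F where "F = {z\<in>space (?A \<Otimes>\<^sub>M ?B). Z \<omega> (fst z) (snd z) \<in> E}"
    have XA: "X i \<in> ?A \<rightarrow>\<^sub>M borel" if "i \<in> J" "b i \<le> t" for i
      using that b l by (intro measurable_gen_sigma X) auto
    have XB: "X i \<in> ?B \<rightarrow>\<^sub>M borel" if "i \<in> J" "b i = Suc t" for i
      using that l by (intro measurable_gen_sigma X) auto
    have "(\<lambda>z. Z \<omega> (fst z) (snd z)) \<in> ?A \<Otimes>\<^sub>M ?B \<rightarrow>\<^sub>M PiM J (\<lambda>_. borel)"
      unfolding Z_def
    proof (rule measurable_restrict)
      fix i assume "i \<in> J"
      then show "(\<lambda>z. if b i \<le> t then X i (fst z) else if b i = Suc t then X i (snd z) else X i (\<omega> (b i))) \<in> ?A \<Otimes>\<^sub>M ?B \<rightarrow>\<^sub>M borel"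
        using measurable_compose[OF measurable_fst XA[of i], of ?B] measurable_compose[OF measurable_snd XB[of i], of ?A]
        by (cases "b i \<le> t"; cases "b i = Suc t") simp_all
    qed
    then have F: "F \<in> sets (?A \<Otimes>\<^sub>M ?B)" unfolding F_def using E by measurable
    have idA: "(\<lambda>x. x) \<in> M \<rightarrow>\<^sub>M gen_sigma M X K" for K
      using sets_gen_sigma_subset[where X=X and M=M and I=K, OF X]
      by (auto simp: measurable_def sets.sets_into_space inf.absorb1 subset_iff)
    have "(\<lambda>z. z) \<in> M \<Otimes>\<^sub>M M \<rightarrow>\<^sub>M ?A \<Otimes>\<^sub>M ?B"
      using measurable_compose[OF measurable_fst[of M M] idA[of "{1..l}"]]
        measurable_compose[OF measurable_snd[of M M] idA[of "{l + int L..}"]]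
      by (subst measurable_pair_iff) (auto simp: comp_def)
    from measurable_sets[OF this F] have FM: "F \<in> sets (M \<Otimes>\<^sub>M M)"
      using sets.sets_into_space[OF F] by (simp add: space_pair_measure inf.absorb1)
    have "(\<lambda>x. (x, x)) \<in> M \<rightarrow>\<^sub>M M \<Otimes>\<^sub>M M" by measurable
    from measurable_sets[OF this FM] have DM: "{y\<in>space M. (y, y) \<in> F} \<in> sets M"
      by (simp add: vimage_def Int_def conj_commute)
    have "(\<integral>x. \<integral>y. ?f (Suc t) \<omega> x y \<partial>M \<partial>M) = (\<integral>y. indicat_real E (Z \<omega> y y) \<partial>M)"
      unfolding W1 by (simp add: prob_space)
    also have "\<dots> = (\<integral>y. indicat_real {y\<in>space M. (y, y) \<in> F} y \<partial>M)"
      by (intro Bochner_Integration.integral_cong) (auto simp: indicator_def F_def space_pair_measure)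
    also have "\<dots> = measure M {y\<in>space M. (y, y) \<in> F}"
      using DM by (subst Bochner_Integration.integral_indicator) (auto simp: Int_def intro!: arg_cong[of _ _ "measure M"])
    finally have e1: "(\<integral>x. \<integral>y. ?f (Suc t) \<omega> x y \<partial>M \<partial>M) = measure M {y\<in>space M. (y, y) \<in> F}" .
    have "(\<integral>x. \<integral>y. ?f t \<omega> x y \<partial>M \<partial>M) = (\<integral>x. \<integral>y. indicat_real F (x, y) \<partial>M \<partial>M)"
      unfolding W0
      by (intro Bochner_Integration.integral_cong refl) (auto simp: indicator_def F_def space_pair_measure)
    also have "\<dots> = (\<integral>z. indicat_real F z \<partial>(M \<Otimes>\<^sub>M M))"
      by (rule MM.integral_fst') (use FM in \<open>auto intro!: MM.integrable_const_bound[where B=1]\<close>)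
    also have "\<dots> = measure (M \<Otimes>\<^sub>M M) F"
      using FM sets.sets_into_space[OF FM] by (subst Bochner_Integration.integral_indicator) (auto simp: inf.absorb1)
    finally have e0: "(\<integral>x. \<integral>y. ?f t \<omega> x y \<partial>M \<partial>M) = measure (M \<Otimes>\<^sub>M M) F" .
    have "\<bar>measure M {y\<in>space M. (y, y) \<in> F} - measure (M \<Otimes>\<^sub>M M) F\<bar> \<le> 2 * beta_alg M ?A ?B"
      by (rule beta_alg_total_variation[OF M _ _ _ _ F]) (auto dest: subsetD[OF sets_gen_sigma_subset, rotated])
    also have "\<dots> \<le> 2 * beta_mix M X L"
      using beta_alg_le_beta_mix[OF M X l(1)] by simp
    finally show ?thesis unfolding e1 e0 .
  qed
  have st: "Suc t \<le> m" "t \<le> m" using t by auto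
  have "\<bar>measure Q {\<omega>\<in>space Q. W (Suc t) \<omega> \<in> E} - measure Q {\<omega>\<in>space Q. W t \<omega> \<in> E}\<bar>
    = \<bar>\<integral>\<omega>. ((\<integral>x. \<integral>y. ?f (Suc t) \<omega> x y \<partial>M \<partial>M) - (\<integral>x. \<integral>y. ?f t \<omega> x y \<partial>M \<partial>M)) \<partial>PiM I (\<lambda>_. M)\<bar>"
    unfolding H[OF st(1)] H[OF st(2)] using int[OF st(1)] int[OF st(2)] by simp
  also have "\<dots> \<le> 2 * beta_mix M X L"
    by (rule QI.abs_expectation_le) (rule pw)
  finally show ?thesis .
qed

text \<open>Telescoping over \<open>t\<close>: each step merges one more block into the past at a
  cost of 2\<beta>(L). The number \<open>l\<close> marks a cut between the blocks up to
  \<open>t\<close> and block \<open>Suc t\<close>, with a gap of \<open>L\<close>.\<close>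

lemma independent_blocks_comparison:
  fixes X :: "int \<Rightarrow> 'w \<Rightarrow> 's::topological_space" and b :: "int \<Rightarrow> nat"
  assumes M: "prob_space M" and X[measurable]: "\<And>i. X i \<in> M \<rightarrow>\<^sub>M borel"
    and b: "\<And>i. i \<in> J \<Longrightarrow> 1 \<le> i \<and> b i \<le> m"
    and l: "\<And>t. t < m \<Longrightarrow> \<exists>l\<ge>1. \<forall>i\<in>J. (b i \<le> t \<longrightarrow> i \<le> l) \<and> (b i = Suc t \<longrightarrow> l + int L \<le> i)"
    and E[measurable]: "E \<in> sets (PiM J (\<lambda>_. borel))"
  defines "Q \<equiv> PiM {..m} (\<lambda>_. M)"
  shows "measure M {\<omega>\<in>space M. (\<lambda>i\<in>J. X i \<omega>) \<in> E}
    \<le> measure Q {\<omega>\<in>space Q. (\<lambda>i\<in>J. X i (\<omega> (b i))) \<in> E} + 2 * real m * beta_mix M X L"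
proof -
  interpret prob_space M by fact
  define H where "H t = measure Q {\<omega>\<in>space Q. (\<lambda>i\<in>J. X i (\<omega> (max (b i) t))) \<in> E}" for t
  have "H t \<le> H 0 + 2 * real t * beta_mix M X L" if "t \<le> m" for t
    using that
  proof (induction t)
    case (Suc t)
    then obtain k where "k \<ge> 1" "\<forall>i\<in>J. (b i \<le> t \<longrightarrow> i \<le> k) \<and> (b i = Suc t \<longrightarrow> k + int L \<le> i)"
      using l[of t] by auto
    then have "\<bar>H (Suc t) - H t\<bar> \<le> 2 * beta_mix M X L"
      unfolding H_def Q_def using Suc.prems by (intro block_merge_step[where l=k] M X b E) auto
    with Suc show ?case by (auto simp: algebra_simps)
  qed simp
  from this[of m] have "H m \<le> H 0 + 2 * real m * beta_mix M X L" by simp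
  moreover have "H 0 = measure Q {\<omega>\<in>space Q. (\<lambda>i\<in>J. X i (\<omega> (b i))) \<in> E}"
    unfolding H_def by simp
  \<comment> \<open>At the last stage every index reads the single coordinate \<open>m\<close>,
    whose law is \<open>M\<close>, so the original process is recovered.\<close>
  moreover have "H m = measure M {\<omega>\<in>space M. (\<lambda>i\<in>J. X i \<omega>) \<in> E}"
  proof -
    have "(\<lambda>i\<in>J. X i (\<omega> (max (b i) m))) = (\<lambda>i\<in>J. X i (\<omega> m))" for \<omega>
      using b by (intro restrict_ext) (auto simp: max_absorb2)
    then have "H m = measure Q {\<omega>\<in>space Q. (\<lambda>i\<in>J. X i (\<omega> m)) \<in> E}"
      unfolding H_def by simp
    also have "\<dots> = measure (distr Q M (\<lambda>\<omega>. \<omega> m)) {\<omega>\<in>space M. (\<lambda>i\<in>J. X i \<omega>) \<in> E}"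
      unfolding Q_def by (subst measure_distr)
        (auto intro!: arg_cong[of _ _ "measure (PiM {..m} (\<lambda>_. M))"] simp: space_PiM)
    also have "distr Q M (\<lambda>\<omega>. \<omega> m) = M"
      unfolding Q_def by (rule distr_PiM_component) (auto intro: M)
    finally show ?thesis .
  qed
  ultimately show ?thesis by simp
qed

section \<open>A maximal inequality\<close>

text \<open>The sum, over all dyadic subintervals of [a, a + 2^N), of the squared norm of the sum of
  \<open>f\<close> over that subinterval.\<close>

primrec dyadic_energy :: "(nat \<Rightarrow> 'h::real_normed_vector) \<Rightarrow> nat \<Rightarrow> nat \<Rightarrow> real" where
  "dyadic_energy f 0 a = (norm (f a))\<^sup>2"
| "dyadic_energy f (Suc N) a =
     (norm (\<Sum>j\<in>{a..<a + 2 ^ Suc N}. f j))\<^sup>2 + dyadic_energy f N a + dyadic_energy f N (a + 2 ^ N)"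

lemma dyadic_energy_nonneg: "0 \<le> dyadic_energy f N a"
  by (induction N arbitrary: a) (auto intro!: add_nonneg_nonneg)

lemma norm_sum_le_dyadic_energy: "(norm (\<Sum>j\<in>{a..<a + 2 ^ N}. f j))\<^sup>2 \<le> dyadic_energy f N a"
  by (cases N) (auto intro!: add_increasing2 dyadic_energy_nonneg)

text \<open>Binary expansion cuts an initial segment into at most N+1 dyadic intervals of different
  levels, and Cauchy-Schwarz gives the factor N+1. The bound is pointwise and its right side is free
  of \<open>n\<close>, so it controls all partial sums at once.\<close>

lemma Rademacher_Menshov:
  "n \<le> 2 ^ N \<Longrightarrow> (norm (\<Sum>j\<in>{a..<a + n}. f j))\<^sup>2 \<le> real (Suc N) * dyadic_energy f N a"
proof (induction N arbitrary: a n)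
  case 0
  then have "n = 0 \<or> n = 1" by auto
  then show ?case by auto
next
  case (Suc N)
  let ?T = "dyadic_energy f N a" and ?T' = "dyadic_energy f N (a + 2 ^ N)"
  have pos: "0 \<le> ?T" "0 \<le> ?T'" by (rule dyadic_energy_nonneg)+
  have le: "?T + ?T' \<le> dyadic_energy f (Suc N) a" by simp
  show ?case
  proof (cases "n \<le> 2 ^ N")
    case True
    have "(norm (\<Sum>j\<in>{a..<a + n}. f j))\<^sup>2 \<le> real (Suc N) * ?T" by (rule Suc.IH[OF True])
    also have "\<dots> \<le> real (Suc (Suc N)) * dyadic_energy f (Suc N) a"
      using pos le by (intro mult_mono) auto
    finally show ?thesis .
  next
    case False
    define k where "k = n - 2 ^ N"
    have n: "n = 2 ^ N + k" and k: "k \<le> 2 ^ N" using False Suc.prems by (auto simp: k_def)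
    let ?x = "norm (\<Sum>j\<in>{a..<a + 2 ^ N}. f j)" and ?y = "norm (\<Sum>j\<in>{a + 2 ^ N..<a + 2 ^ N + k}. f j)"
    have x: "?x\<^sup>2 \<le> ?T" by (rule norm_sum_le_dyadic_energy)
    have y: "?y\<^sup>2 \<le> real (Suc N) * ?T'" by (rule Suc.IH[OF k])
    have "(\<Sum>j\<in>{a..<a + n}. f j) = (\<Sum>j\<in>{a..<a + 2 ^ N}. f j) + (\<Sum>j\<in>{a + 2 ^ N..<a + 2 ^ N + k}. f j)"
      unfolding n by (subst sum.atLeastLessThan_concat) (auto simp: add.assoc)
    then have "norm (\<Sum>j\<in>{a..<a + n}. f j) \<le> ?x + ?y" by (simp add: norm_triangle_ineq)
    then have "(norm (\<Sum>j\<in>{a..<a + n}. f j))\<^sup>2 \<le> (?x + ?y)\<^sup>2" by (intro power_mono) auto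
    also have "\<dots> \<le> real (Suc (Suc N)) * (?T + ?T')"
    proof -
      define s where "s = real (Suc N)"
      have s: "s > 0" "real (Suc (Suc N)) = s + 1" by (auto simp: s_def)
      \<comment> \<open>Cauchy-Schwarz with weight s on x: the left half is a full dyadic interval
        and satisfies x^2 <= T without a factor, whereas y^2 <= s T'. This weighting raises the
        factor from s to exactly s+1.\<close>
      have "s * (?x + ?y)\<^sup>2 + (s * ?x - ?y)\<^sup>2 = (s + 1) * (s * ?x\<^sup>2 + ?y\<^sup>2)"
        by (simp add: power2_eq_square algebra_simps)
      then have "s * (?x + ?y)\<^sup>2 \<le> (s + 1) * (s * ?x\<^sup>2 + ?y\<^sup>2)"
        using zero_le_power2[of "s * ?x - ?y"] by linarith
      also have "\<dots> \<le> (s + 1) * (s * ?T + s * ?T')"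
        using x y s(1) by (intro mult_left_mono add_mono) (auto simp: s_def)
      also have "\<dots> = s * ((s + 1) * (?T + ?T'))" by (simp add: algebra_simps)
      finally show ?thesis using s by (simp only: mult_le_cancel_left_pos)
    qed
    also have "\<dots> \<le> real (Suc (Suc N)) * dyadic_energy f (Suc N) a"
      using le by (intro mult_left_mono) auto
    finally show ?thesis .
  qed
qed

text \<open>There are N+1 levels, and the intervals of one level are disjoint with total length 2^N,
  so each level contributes at most K 2^N.\<close>

lemma dyadic_energy_expectation:
  fixes f :: "nat \<Rightarrow> 'w \<Rightarrow> 'h::real_normed_vector"
  assumes int: "\<And>a n. integrable M (\<lambda>\<omega>. (norm (\<Sum>j\<in>{a..<a + n}. f j \<omega>))\<^sup>2)"
    and le: "\<And>a n. (\<integral>\<omega>. (norm (\<Sum>j\<in>{a..<a + n}. f j \<omega>))\<^sup>2 \<partial>M) \<le> K * real n"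
  shows "integrable M (\<lambda>\<omega>. dyadic_energy (\<lambda>j. f j \<omega>) N a) \<and>
    (\<integral>\<omega>. dyadic_energy (\<lambda>j. f j \<omega>) N a \<partial>M) \<le> K * real (Suc N) * 2 ^ N"
proof (induction N arbitrary: a)
  case 0
  show ?case using int[of a 1] le[of a 1] by simp
next
  case (Suc N)
  note i = int[of a "2 ^ Suc N"] Suc[THEN conjunct1, of a] Suc[THEN conjunct1, of "a + 2 ^ N"]
  have "(\<integral>\<omega>. dyadic_energy (\<lambda>j. f j \<omega>) (Suc N) a \<partial>M)
    = (\<integral>\<omega>. (norm (\<Sum>j\<in>{a..<a + 2 ^ Suc N}. f j \<omega>))\<^sup>2 \<partial>M)
      + (\<integral>\<omega>. dyadic_energy (\<lambda>j. f j \<omega>) N a \<partial>M) + (\<integral>\<omega>. dyadic_energy (\<lambda>j. f j \<omega>) N (a + 2 ^ N) \<partial>M)"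
    unfolding dyadic_energy.simps using i by simp
  also have "\<dots> \<le> K * real (2 ^ Suc N) + K * real (Suc N) * 2 ^ N + K * real (Suc N) * 2 ^ N"
    by (intro add_mono le Suc[THEN conjunct2])
  also have "\<dots> = K * real (Suc (Suc N)) * 2 ^ Suc N" by (simp add: algebra_simps)
  finally show ?case using i by simp
qed

text \<open>Markov's inequality for the one random variable that dominates all partial sums. One
  factor N+1 comes from the pointwise bound, the other from the number of levels.\<close>

lemma maximal_inequality:
  fixes f :: "nat \<Rightarrow> 'w \<Rightarrow> 'h::{real_normed_vector, second_countable_topology}"
  assumes M: "prob_space M" and [measurable]: "\<And>j. f j \<in> borel_measurable M"
    and int: "\<And>a n. integrable M (\<lambda>\<omega>. (norm (\<Sum>j\<in>{a..<a + n}. f j \<omega>))\<^sup>2)"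
    and le: "\<And>a n. (\<integral>\<omega>. (norm (\<Sum>j\<in>{a..<a + n}. f j \<omega>))\<^sup>2 \<partial>M) \<le> K * real n"
    and c: "c > 0"
  shows "measure M {\<omega>\<in>space M. \<exists>n\<le>2 ^ N. c < norm (\<Sum>j\<in>{a..<a + n}. f j \<omega>)}
    \<le> K * (real (Suc N))\<^sup>2 * 2 ^ N / c\<^sup>2"
proof -
  interpret prob_space M by fact
  note E = dyadic_energy_expectation[of M f K N a, OF int le]
  let ?u = "\<lambda>\<omega>. real (Suc N) * dyadic_energy (\<lambda>j. f j \<omega>) N a"
  have u: "integrable M ?u" using E by simp
  then have [measurable]: "?u \<in> borel_measurable M" by auto
  have "measure M {\<omega>\<in>space M. \<exists>n\<le>2 ^ N. c < norm (\<Sum>j\<in>{a..<a + n}. f j \<omega>)}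
    \<le> measure M {\<omega>\<in>space M. ?u \<omega> \<ge> c\<^sup>2}"
  proof (rule finite_measure_mono)
    show "{\<omega>\<in>space M. \<exists>n\<le>2 ^ N. c < norm (\<Sum>j\<in>{a..<a + n}. f j \<omega>)} \<subseteq> {\<omega>\<in>space M. ?u \<omega> \<ge> c\<^sup>2}"
    proof safe
      fix \<omega> n assume n: "n \<le> 2 ^ N" "c < norm (\<Sum>j\<in>{a..<a + n}. f j \<omega>)"
      have "c\<^sup>2 \<le> (norm (\<Sum>j\<in>{a..<a + n}. f j \<omega>))\<^sup>2" using n c by (intro power_mono) auto
      also have "\<dots> \<le> ?u \<omega>" using Rademacher_Menshov[OF n(1)] .
      finally show "c\<^sup>2 \<le> ?u \<omega>" .
    qed
  qed measurable
  also have "\<dots> \<le> (\<integral>\<omega>. ?u \<omega> \<partial>M) / c\<^sup>2"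
    by (rule integral_Markov_inequality_measure[OF u sets.top]) (use c in \<open>auto intro!: mult_nonneg_nonneg dyadic_energy_nonneg\<close>)
  also have "\<dots> \<le> K * (real (Suc N))\<^sup>2 * 2 ^ N / c\<^sup>2"
  proof (rule divide_right_mono)
    have "(\<integral>\<omega>. ?u \<omega> \<partial>M) = real (Suc N) * (\<integral>\<omega>. dyadic_energy (\<lambda>j. f j \<omega>) N a \<partial>M)" by simp
    also have "\<dots> \<le> real (Suc N) * (K * real (Suc N) * 2 ^ N)"
      using E by (intro mult_left_mono) auto
    finally show "(\<integral>\<omega>. ?u \<omega> \<partial>M) \<le> K * (real (Suc N))\<^sup>2 * 2 ^ N" by (simp add: power2_eq_square algebra_simps)
  qed simp
  finally show ?thesis .
qed

section \<open>Second moments of degenerate sums over independent blocks\<close>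

lemma indep_var_PiM_coordinates:
  assumes M: "\<And>i. i \<in> I \<Longrightarrow> prob_space (M i)" and st: "s \<in> I" "t \<in> I" "s \<noteq> t"
    and f: "f \<in> M s \<rightarrow>\<^sub>M N" and g: "g \<in> M t \<rightarrow>\<^sub>M N'"
  shows "prob_space.indep_var (PiM I M) N (\<lambda>w. f (w s)) N' (\<lambda>w. g (w t))"
proof -
  interpret Q: prob_space "PiM I M" using M by (rule prob_space_PiM)
  have "Q.indep_vars M (\<lambda>i w. w i) I"
  proof (subst Q.indep_vars_iff_distr_eq_PiM')
    have "distr (PiM I M) (PiM I M) (\<lambda>w. \<lambda>i\<in>I. w i) = distr (PiM I M) (PiM I M) (\<lambda>w. w)"
      by (intro distr_cong refl) (auto simp: space_PiM PiE_restrict)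
    also have "\<dots> = PiM I M" by simp
    also have "\<dots> = PiM I (\<lambda>i. distr (PiM I M) (M i) (\<lambda>w. w i))"
      by (intro PiM_cong refl distr_PiM_component[symmetric] M)
    finally show "distr (PiM I M) (PiM I M) (\<lambda>w. \<lambda>i\<in>I. w i) = PiM I (\<lambda>i. distr (PiM I M) (M i) (\<lambda>w. w i))" .
  qed (use assms in auto)
  from Q.indep_var_restrict[OF this, of "{s}" "{t}"] st
  have "Q.indep_var (PiM {s} M) (\<lambda>w. restrict w {s}) (PiM {t} M) (\<lambda>w. restrict w {t})" by simp
  then have "Q.indep_var N ((\<lambda>w. f (w s)) \<circ> (\<lambda>w. restrict w {s})) N' ((\<lambda>w. g (w t)) \<circ> (\<lambda>w. restrict w {t}))"
  proof (rule Q.indep_var_compose)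
    show "(\<lambda>w. f (w s)) \<in> PiM {s} M \<rightarrow>\<^sub>M N" "(\<lambda>w. g (w t)) \<in> PiM {t} M \<rightarrow>\<^sub>M N'"
      using f g by measurable
  qed
  then show ?thesis by (simp add: comp_def)
qed

text \<open>Integrate coordinate \<open>c\<close> first: \<open>G\<close> does not depend on it, and
  \<open>F\<close> has mean zero in it.\<close>

lemma PiM_orthogonal:
  fixes F G :: "('i \<Rightarrow> 'w) \<Rightarrow> 'h::{real_inner, banach, second_countable_topology}"
  assumes M: "prob_space M" and I: "finite I" "c \<in> I"
    and G: "\<And>w y. G (w(c := y)) = G w"
    and int: "integrable (PiM I (\<lambda>_. M)) (\<lambda>w. inner (G w) (F w))"
    and F: "AE w in PiM (I - {c}) (\<lambda>_. M). integrable M (\<lambda>y. F (w(c := y))) \<and> (\<integral>y. F (w(c := y)) \<partial>M) = 0"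
  shows "(\<integral>w. inner (G w) (F w) \<partial>PiM I (\<lambda>_. M)) = 0"
proof -
  interpret prob_space M by fact
  interpret P: product_prob_space "\<lambda>_::'i. M" UNIV ..
  have I': "insert c (I - {c}) = I" using I by auto
  have "(\<integral>w. inner (G w) (F w) \<partial>PiM I (\<lambda>_. M))
    = (\<integral>w. \<integral>y. inner (G (w(c := y))) (F (w(c := y))) \<partial>M \<partial>PiM (I - {c}) (\<lambda>_. M))"
    using P.product_integral_insert[of "I - {c}" c "\<lambda>w. inner (G w) (F w)"] int I unfolding I' by simp
  also have "\<dots> = 0"
    by (rule integral_eq_zero_AE) (use F in \<open>eventually_elim, simp add: G\<close>)
  finally show ?thesis .
qed


text \<open>Degeneracy is expressed through integrals against the common marginal \<mu>, the form in
  which it is used when one block is integrated out. Square integrability refers to the product law,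
  the only one under which second moments are taken.\<close>

locale degenerate_kernel = prob_space M for M :: "'w measure" +
  fixes X :: "int \<Rightarrow> 'w \<Rightarrow> 's::{metric_space, second_countable_topology}"
    and \<mu> :: "'s measure"
    and h :: "'s \<Rightarrow> 's \<Rightarrow> 'h::{real_inner, banach, second_countable_topology}"
  assumes X [measurable]: "\<And>i. X i \<in> M \<rightarrow>\<^sub>M borel"
    and law: "\<And>i. distr M borel (X i) = \<mu>"
    and h: "(\<lambda>(x, y). h x y) \<in> borel \<Otimes>\<^sub>M borel \<rightarrow>\<^sub>M borel"
    and deg2: "AE x in \<mu>. integrable \<mu> (h x) \<and> (\<integral>y. h x y \<partial>\<mu>) = 0"
    and deg1: "AE y in \<mu>. integrable \<mu> (\<lambda>x. h x y) \<and> (\<integral>x. h x y \<partial>\<mu>) = 0"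
    and sq: "integrable (\<mu> \<Otimes>\<^sub>M \<mu>) (\<lambda>z. (norm (h (fst z) (snd z)))\<^sup>2)"
begin

definition energy :: real where
  "energy = (\<integral>z. (norm (h (fst z) (snd z)))\<^sup>2 \<partial>(\<mu> \<Otimes>\<^sub>M \<mu>))"

lemma energy_nonneg: "0 \<le> energy"
  unfolding energy_def by (rule integral_nonneg_AE) simp

lemma h_measurable [measurable (raw)]:
  assumes [measurable]: "f \<in> N \<rightarrow>\<^sub>M borel" "g \<in> N \<rightarrow>\<^sub>M borel"
  shows "(\<lambda>x. h (f x) (g x)) \<in> N \<rightarrow>\<^sub>M borel"
  using measurable_compose[OF measurable_Pair[OF assms] h] by simp

lemma integral_law:
  assumes f[measurable]: "f \<in> borel_measurable borel" and "integrable \<mu> f \<and> integral\<^sup>L \<mu> f = (0::'h)"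
  shows "integrable M (\<lambda>\<omega>. f (X i \<omega>)) \<and> (\<integral>\<omega>. f (X i \<omega>) \<partial>M) = 0"
  using assms(2) unfolding law[of i, symmetric]
  by (simp add: integrable_distr_eq integral_distr)

context
  fixes b :: "int \<Rightarrow> nat" and m :: nat
begin

abbreviation "block_space \<equiv> PiM {..m} (\<lambda>_. M)"

definition block_kernel :: "int \<times> int \<Rightarrow> (nat \<Rightarrow> 'w) \<Rightarrow> 'h" where
  "block_kernel p w = h (X (fst p) (w (b (fst p)))) (X (snd p) (w (b (snd p))))"

text \<open>Distinct blocks are independent, so such a pair has the product law. Ordering them makes
  it possible to single out the last block involved in two pairs.\<close>

definition admissible :: "int \<times> int \<Rightarrow> bool" where
  "admissible p \<longleftrightarrow> b (fst p) < b (snd p) \<and> b (snd p) \<le> m"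

lemma prob_space_block_space: "prob_space block_space"
  by (rule prob_space_PiM) (rule prob_space_axioms)

lemma coordinate_measurable [measurable]: "b i \<le> m \<Longrightarrow> (\<lambda>w. X i (w (b i))) \<in> block_space \<rightarrow>\<^sub>M borel"
  by measurable

lemma block_kernel_measurable: "admissible p \<Longrightarrow> block_kernel p \<in> block_space \<rightarrow>\<^sub>M borel"
  unfolding block_kernel_def[abs_def] admissible_def by measurable

lemma joint_law:
  assumes "b i \<le> m" "b j \<le> m" "b i \<noteq> b j"
  shows "distr block_space (borel \<Otimes>\<^sub>M borel) (\<lambda>w. (X i (w (b i)), X j (w (b j)))) = \<mu> \<Otimes>\<^sub>M \<mu>"
proof -
  interpret Q: prob_space block_space by (rule prob_space_block_space)
  have *: "distr block_space borel (\<lambda>w. X i (w (b i))) = \<mu>" if "b i \<le> m" for i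
  proof -
    have "distr block_space borel (\<lambda>w. X i (w (b i))) = distr (distr block_space M (\<lambda>w. w (b i))) borel (X i)"
      using that by (subst distr_distr) (auto simp: comp_def)
    also have "distr block_space M (\<lambda>w. w (b i)) = M"
      by (rule distr_PiM_component) (use that prob_space_axioms in auto)
    finally show ?thesis using law by simp
  qed
  have "Q.indep_var borel (\<lambda>w. X i (w (b i))) borel (\<lambda>w. X j (w (b j)))"
    by (rule indep_var_PiM_coordinates) (use assms prob_space_axioms in auto)
  then show ?thesis using * assms by (simp add: Q.indep_var_distribution_eq)
qed

lemma block_kernel_square:
  assumes "admissible p"
  shows "integrable block_space (\<lambda>w. (norm (block_kernel p w))\<^sup>2) \<and> (\<integral>w. (norm (block_kernel p w))\<^sup>2 \<partial>block_space) = energy"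
proof -
  let ?T = "\<lambda>w. (X (fst p) (w (b (fst p))), X (snd p) (w (b (snd p))))"
  have p: "b (fst p) \<le> m" "b (snd p) \<le> m" "b (fst p) \<noteq> b (snd p)" using assms by (auto simp: admissible_def)
  note J = joint_law[OF p]
  have [measurable]: "?T \<in> block_space \<rightarrow>\<^sub>M borel \<Otimes>\<^sub>M borel" using p by measurable
  have [measurable]: "(\<lambda>z. (norm (h (fst z) (snd z)))\<^sup>2) \<in> borel_measurable (borel \<Otimes>\<^sub>M borel)" by measurable
  have "integrable block_space (\<lambda>w. (norm (h (fst (?T w)) (snd (?T w))))\<^sup>2)"
    using sq unfolding J[symmetric] by (subst (asm) integrable_distr_eq) auto
  moreover have "(\<integral>w. (norm (h (fst (?T w)) (snd (?T w))))\<^sup>2 \<partial>block_space) = energy"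
    unfolding energy_def J[symmetric] by (subst integral_distr) auto
  ultimately show ?thesis by (simp add: block_kernel_def)
qed

lemma block_kernel_inner:
  assumes "admissible p" "admissible q"
  shows "integrable block_space (\<lambda>w. inner (block_kernel p w) (block_kernel q w)) \<and> (\<integral>w. inner (block_kernel p w) (block_kernel q w) \<partial>block_space) \<le> energy"
proof -
  note [measurable] = block_kernel_measurable[OF assms(1)] block_kernel_measurable[OF assms(2)]
  note S = block_kernel_square[OF assms(1)] block_kernel_square[OF assms(2)]
  have bd: "\<bar>inner (block_kernel p w) (block_kernel q w)\<bar> \<le> ((norm (block_kernel p w))\<^sup>2 + (norm (block_kernel q w))\<^sup>2) / 2" for w
  proof -
    have "\<bar>inner (block_kernel p w) (block_kernel q w)\<bar> \<le> norm (block_kernel p w) * norm (block_kernel q w)" by (rule Cauchy_Schwarz_ineq2)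
    also have "\<dots> \<le> ((norm (block_kernel p w))\<^sup>2 + (norm (block_kernel q w))\<^sup>2) / 2"
      using sum_squares_bound[of "norm (block_kernel p w)" "norm (block_kernel q w)"] by simp
    finally show ?thesis .
  qed
  have i: "integrable block_space (\<lambda>w. ((norm (block_kernel p w))\<^sup>2 + (norm (block_kernel q w))\<^sup>2) / 2)" using S by simp
  have int: "integrable block_space (\<lambda>w. inner (block_kernel p w) (block_kernel q w))"
    by (rule Bochner_Integration.integrable_bound[OF i]) (use bd in \<open>auto simp: abs_of_nonneg\<close>)
  have "(\<integral>w. inner (block_kernel p w) (block_kernel q w) \<partial>block_space) \<le> (\<integral>w. ((norm (block_kernel p w))\<^sup>2 + (norm (block_kernel q w))\<^sup>2) / 2 \<partial>block_space)"
    by (rule integral_mono[OF int i]) (use bd abs_le_D1 in blast)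
  also have "\<dots> = energy" using S by simp
  finally show ?thesis using int by blast
qed

text \<open>Carries the exceptional null set of the degeneracy condition over to the coordinates
  that remain after \<open>c\<close> has been integrated out.\<close>

lemma AE_coordinate:
  assumes "AE x in \<mu>. P x" "b i \<le> m" "b i \<noteq> c"
  shows "AE w in PiM ({..m} - {c}) (\<lambda>_. M). P (X i (w (b i)))"
proof -
  have "AE \<omega> in M. P (X i \<omega>)"
    using assms(1) unfolding law[of i, symmetric] by (rule AE_distrD[OF X])
  then show ?thesis
    using assms prob_space_axioms
    by (intro AE_PiM_component[where I="{..m} - {c}" and M="\<lambda>_. M" and i="b i" and P="\<lambda>\<omega>. P (X i \<omega>)"]) auto
qed

lemma block_kernel_orthogonal_snd:
  assumes "admissible p" "admissible q" "b (snd q) \<noteq> b (fst p)" "b (snd q) \<noteq> b (snd p)"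
  shows "(\<integral>w. inner (block_kernel p w) (block_kernel q w) \<partial>block_space) = 0"
proof (rule PiM_orthogonal[where c="b (snd q)"])
  have q: "b (fst q) \<noteq> b (snd q)" "b (fst q) \<le> m" "b (snd q) \<le> m" using assms by (auto simp: admissible_def)
  show "block_kernel p (w(b (snd q) := y)) = block_kernel p w" for w y using assms by (simp add: block_kernel_def)
  show "AE w in PiM ({..m} - {b (snd q)}) (\<lambda>_. M).
    integrable M (\<lambda>y. block_kernel q (w(b (snd q) := y))) \<and> (\<integral>y. block_kernel q (w(b (snd q) := y)) \<partial>M) = 0"
    using AE_coordinate[OF deg2 q(2) q(1)]
  proof eventually_elim
    case (elim w)
    from integral_law[OF _ this, of "snd q"] show ?case using q by (simp add: block_kernel_def)
  qed
qed (use assms prob_space_axioms block_kernel_inner in \<open>auto simp: admissible_def\<close>)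

lemma block_kernel_orthogonal_fst:
  assumes "admissible p" "admissible q" "b (fst q) \<noteq> b (fst p)" "b (fst q) \<noteq> b (snd p)"
  shows "(\<integral>w. inner (block_kernel p w) (block_kernel q w) \<partial>block_space) = 0"
proof (rule PiM_orthogonal[where c="b (fst q)"])
  have q: "b (snd q) \<noteq> b (fst q)" "b (fst q) \<le> m" "b (snd q) \<le> m" using assms by (auto simp: admissible_def)
  show "block_kernel p (w(b (fst q) := y)) = block_kernel p w" for w y using assms by (simp add: block_kernel_def)
  show "AE w in PiM ({..m} - {b (fst q)}) (\<lambda>_. M).
    integrable M (\<lambda>y. block_kernel q (w(b (fst q) := y))) \<and> (\<integral>y. block_kernel q (w(b (fst q) := y)) \<partial>M) = 0"
    using AE_coordinate[OF deg1 q(3) q(1)]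
  proof eventually_elim
    case (elim w)
    from integral_law[OF _ this, of "fst q"] show ?case using q by (simp add: block_kernel_def)
  qed
qed (use assms prob_space_axioms block_kernel_inner in \<open>auto simp: admissible_def\<close>)

text \<open>Some block occurs in exactly one of the two pairs, and integrating it out gives zero. If
  the last blocks differ, it is the larger of them; otherwise it is a first block, which lies
  strictly below the common last one.\<close>

lemma block_kernel_orthogonal:
  assumes "admissible p" "admissible q" "\<not> (b (fst p) = b (fst q) \<and> b (snd p) = b (snd q))"
  shows "(\<integral>w. inner (block_kernel p w) (block_kernel q w) \<partial>block_space) = 0"
proof -
  have lt: "b (fst p) < b (snd p)" "b (fst q) < b (snd q)" using assms by (auto simp: admissible_def)
  consider "b (snd p) < b (snd q)" | "b (snd q) < b (snd p)"
    | "b (snd p) = b (snd q)" "b (fst p) \<noteq> b (fst q)" using assms(3) by linarith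
  then show ?thesis
  proof cases
    case 1
    then show ?thesis using lt assms by (intro block_kernel_orthogonal_snd) auto
  next
    case 2
    then have "(\<integral>w. inner (block_kernel q w) (block_kernel p w) \<partial>block_space) = 0" using lt assms by (intro block_kernel_orthogonal_snd) auto
    then show ?thesis by (simp add: inner_commute)
  next
    case 3
    then show ?thesis using lt assms by (intro block_kernel_orthogonal_fst) auto
  qed
qed

text \<open>For fixed \<open>p\<close> only pairs using the same two blocks survive; there are at
  most V^2 of them, and each inner product has integral at most \<open>energy\<close>. Linearity in
  the number of pairs is what the maximal inequality requires.\<close>

lemma second_moment_bound:
  assumes A: "finite A" "\<And>p. p \<in> A \<Longrightarrow> admissible p"
    and T: "finite T" "A \<subseteq> T \<times> T" "\<And>t. card {i\<in>T. b i = t} \<le> V"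
  shows "integrable block_space (\<lambda>w. (norm (\<Sum>p\<in>A. block_kernel p w))\<^sup>2)"
    and "(\<integral>w. (norm (\<Sum>p\<in>A. block_kernel p w))\<^sup>2 \<partial>block_space) \<le> energy * (real V)\<^sup>2 * real (card A)"
proof -
  have ex: "(norm (\<Sum>p\<in>A. block_kernel p w))\<^sup>2 = (\<Sum>p\<in>A. \<Sum>q\<in>A. inner (block_kernel p w) (block_kernel q w))" for w
    by (subst power2_norm_eq_inner, subst inner_sum_left) (simp add: inner_sum_right)
  show "integrable block_space (\<lambda>w. (norm (\<Sum>p\<in>A. block_kernel p w))\<^sup>2)"
    unfolding ex using A block_kernel_inner by (intro Bochner_Integration.integrable_sum) auto
  have "(\<integral>w. (norm (\<Sum>p\<in>A. block_kernel p w))\<^sup>2 \<partial>block_space) = (\<Sum>p\<in>A. \<Sum>q\<in>A. \<integral>w. inner (block_kernel p w) (block_kernel q w) \<partial>block_space)"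
    unfolding ex using A block_kernel_inner
    by (subst Bochner_Integration.integral_sum, force intro!: Bochner_Integration.integrable_sum)
      (intro sum.cong refl Bochner_Integration.integral_sum, auto)
  also have "\<dots> \<le> (\<Sum>p\<in>A. energy * (real V)\<^sup>2)"
  proof (rule sum_mono)
    fix p assume p: "p \<in> A"
    let ?N = "{q\<in>A. b (fst p) = b (fst q) \<and> b (snd p) = b (snd q)}"
    have "(\<Sum>q\<in>A. \<integral>w. inner (block_kernel p w) (block_kernel q w) \<partial>block_space) = (\<Sum>q\<in>?N. \<integral>w. inner (block_kernel p w) (block_kernel q w) \<partial>block_space)"
      by (rule sum.mono_neutral_right) (use A p block_kernel_orthogonal in auto)
    also have "\<dots> \<le> (\<Sum>q\<in>?N. energy)"
      using A p block_kernel_inner by (intro sum_mono) auto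
    also have "\<dots> = energy * real (card ?N)" by simp
    also have "\<dots> \<le> energy * (real V)\<^sup>2"
    proof (rule mult_left_mono[OF _ energy_nonneg])
      have "?N \<subseteq> {i\<in>T. b i = b (fst p)} \<times> {i\<in>T. b i = b (snd p)}" using T(2) by auto
      then have "card ?N \<le> card ({i\<in>T. b i = b (fst p)} \<times> {i\<in>T. b i = b (snd p)})"
        using T(1) by (intro card_mono) auto
      also have "\<dots> \<le> V * V" unfolding card_cartesian_product by (intro mult_mono T(3)) auto
      finally have "real (card ?N) \<le> real (V * V)" by (simp only: of_nat_le_iff)
      then show "real (card ?N) \<le> (real V)\<^sup>2" by (simp add: power2_eq_square)
    qed
    finally show "(\<Sum>q\<in>A. \<integral>w. inner (block_kernel p w) (block_kernel q w) \<partial>block_space) \<le> energy * (real V)\<^sup>2" .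
  qed
  also have "\<dots> = energy * (real V)\<^sup>2 * real (card A)" by simp
  finally show "(\<integral>w. (norm (\<Sum>p\<in>A. block_kernel p w))\<^sup>2 \<partial>block_space) \<le> energy * (real V)\<^sup>2 * real (card A)" .
qed

end

end

section \<open>Blocking\<close>

lemma partial_sums_by_second_index:
  fixes A :: "(int \<times> int) set"
  assumes "finite A"
  shows "(\<Sum>j\<in>{a..<a + n}. \<Sum>p\<in>{p\<in>A. snd p = int j}. F p)
    = (\<Sum>p\<in>{p\<in>A. int a \<le> snd p \<and> snd p < int (a + n)}. F p)"
proof -
  have "{p\<in>A. int a \<le> snd p \<and> snd p < int (a + n)} = (\<Union>j\<in>{a..<a + n}. {p\<in>A. snd p = int j})"
  proof safe
    fix x y assume "(x, y) \<in> A" "int a \<le> snd (x, y)" "snd (x, y) < int (a + n)"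
    then show "(x, y) \<in> (\<Union>j\<in>{a..<a + n}. {p\<in>A. snd p = int j})"
      by (intro UN_I[of "nat y"]) auto
  qed auto
  then show ?thesis using assms
    by (simp only:, subst sum.UNION_disjoint) auto
qed

context degenerate_kernel
begin

text \<open>Grouping the pairs by their second index turns the sum up to \<open>n\<close> into a
  partial sum of \<open>f\<close>. An interval of \<open>n\<close> second indices carries at most
  2^N n pairs, whence the constant K = \<open>energy\<close> V^2 2^N in the maximal
  inequality.\<close>

lemma far_pairs_bound:
  assumes J: "J \<subseteq> {1..2 ^ N}" and bm: "\<And>i. i \<in> J \<Longrightarrow> b i \<le> m"
    and l: "\<And>t. t < m \<Longrightarrow> \<exists>l\<ge>1. \<forall>i\<in>J. (b i \<le> t \<longrightarrow> i \<le> l) \<and> (b i = Suc t \<longrightarrow> l + int L \<le> i)"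
    and V: "\<And>t. card {i\<in>J. b i = t} \<le> V"
    and A: "A \<subseteq> J \<times> J" "\<And>p. p \<in> A \<Longrightarrow> b (fst p) < b (snd p)"
    and c: "c > 0"
  shows "measure M {\<omega>\<in>space M. \<exists>n\<le>2 ^ N. c < norm (\<Sum>p\<in>{p\<in>A. snd p \<le> int n}. h (X (fst p) \<omega>) (X (snd p) \<omega>))}
    \<le> energy * (real V)\<^sup>2 * 2 ^ N * (real (Suc N))\<^sup>2 * 2 ^ N / c\<^sup>2 + 2 * real m * beta_mix M X L"
proof -
  let ?Q = "PiM {..m} (\<lambda>_. M)"
  have finJ: "finite J" using J finite_subset by blast
  have finA: "finite A" using A(1) finJ finite_subset by blast
  have admissible: "admissible b m p" if "p \<in> A" for p
    using that A bm by (auto simp: admissible_def)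
  define f where "f j w = (\<Sum>p\<in>{p\<in>A. snd p = int j}. block_kernel b p w)" for j w
  have fsum: "(\<Sum>j\<in>{a..<a + n}. f j w) = (\<Sum>p\<in>{p\<in>A. int a \<le> snd p \<and> snd p < int (a + n)}. block_kernel b p w)" for a n w
    unfolding f_def by (rule partial_sums_by_second_index[OF finA])
  have f_meas: "f j \<in> borel_measurable ?Q" for j
    unfolding f_def[abs_def] by (intro borel_measurable_sum block_kernel_measurable admissible) simp
  have sm: "integrable ?Q (\<lambda>w. (norm (\<Sum>j\<in>{a..<a + n}. f j w))\<^sup>2) \<and>
    (\<integral>w. (norm (\<Sum>j\<in>{a..<a + n}. f j w))\<^sup>2 \<partial>?Q) \<le> energy * (real V)\<^sup>2 * 2 ^ N * real n" for a n
  proof -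
    let ?A = "{p\<in>A. int a \<le> snd p \<and> snd p < int (a + n)}"
    have fin: "finite ?A" using finA by simp
    have "?A \<subseteq> {1..2 ^ N} \<times> {int a..<int (a + n)}" using A(1) J by auto
    then have "card ?A \<le> card ({1..2 ^ N::int} \<times> {int a..<int (a + n)})" by (intro card_mono) auto
    also have "\<dots> = 2 ^ N * n" by (simp add: card_cartesian_product nat_power_eq)
    finally have "real (card ?A) \<le> real (2 ^ N * n)" by (simp only: of_nat_le_iff)
    then have card: "real (card ?A) \<le> 2 ^ N * real n" by simp
    have AJ: "?A \<subseteq> J \<times> J" using A(1) by auto
    have admissible': "admissible b m p" if "p \<in> ?A" for p using admissible that by simp
    note B = second_moment_bound[OF fin admissible' finJ AJ V]
    have "energy * (real V)\<^sup>2 * real (card ?A) \<le> energy * (real V)\<^sup>2 * (2 ^ N * real n)"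
      using card energy_nonneg by (intro mult_left_mono) auto
    then show ?thesis unfolding fsum using B by (auto simp: mult.assoc)
  qed
  \<comment> \<open>The event is written on the coordinate space over \<open>J\<close>, so that the
    same set can be evaluated under the original law and under independent blocks.\<close>
  define E where "E = {x\<in>space (PiM J (\<lambda>_. borel :: 's measure)). \<exists>n\<le>2 ^ N. c < norm (\<Sum>p\<in>{p\<in>A. snd p \<le> int n}. h (x (fst p)) (x (snd p)))}"
  have S: "(\<lambda>x. \<Sum>p\<in>{p\<in>A. snd p \<le> int n}. h (x (fst p)) (x (snd p))) \<in> borel_measurable (PiM J (\<lambda>_. borel))" for n
  proof (rule borel_measurable_sum)
    fix p assume "p \<in> {p\<in>A. snd p \<le> int n}"
    then have "fst p \<in> J" "snd p \<in> J" using A(1) by auto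
    then show "(\<lambda>x. h (x (fst p)) (x (snd p))) \<in> borel_measurable (PiM J (\<lambda>_. borel))" by measurable
  qed
  have E: "E \<in> sets (PiM J (\<lambda>_. borel))"
    unfolding E_def using S by measurable
  have rs: "(\<Sum>p\<in>{p\<in>A. snd p \<le> int n}. h (restrict y J (fst p)) (restrict y J (snd p)))
      = (\<Sum>p\<in>{p\<in>A. snd p \<le> int n}. h (y (fst p)) (y (snd p)))" for n and y :: "int \<Rightarrow> 's"
    using A(1) by (intro sum.cong refl) auto
  have iE: "restrict y J \<in> E \<longleftrightarrow> (\<exists>n\<le>2 ^ N. c < norm (\<Sum>p\<in>{p\<in>A. snd p \<le> int n}. h (y (fst p)) (y (snd p))))"
    for y :: "int \<Rightarrow> 's"
    unfolding E_def mem_Collect_eq rs by (simp add: space_PiM)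
  have one: "(\<Sum>j\<in>{1..<1 + n}. f j w) = (\<Sum>p\<in>{p\<in>A. snd p \<le> int n}. h (X (fst p) (w (b (fst p)))) (X (snd p) (w (b (snd p)))))" for n w
    unfolding fsum block_kernel_def using A(1) J by (intro sum.cong) auto
  have "measure M {\<omega>\<in>space M. (\<lambda>i\<in>J. X i \<omega>) \<in> E}
    \<le> measure ?Q {w\<in>space ?Q. (\<lambda>i\<in>J. X i (w (b i))) \<in> E} + 2 * real m * beta_mix M X L"
    by (rule independent_blocks_comparison[OF prob_space_axioms X _ l E]) (use J bm in auto)
  also have "measure ?Q {w\<in>space ?Q. (\<lambda>i\<in>J. X i (w (b i))) \<in> E}
      = measure ?Q {w\<in>space ?Q. \<exists>n\<le>2 ^ N. c < norm (\<Sum>j\<in>{1..<1 + n}. f j w)}"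
    unfolding iE one ..
  also have "\<dots> \<le> energy * (real V)\<^sup>2 * 2 ^ N * (real (Suc N))\<^sup>2 * 2 ^ N / c\<^sup>2"
    by (rule maximal_inequality[OF prob_space_block_space f_meas]) (use sm c in auto)
  finally show ?thesis unfolding iE by simp
qed

text \<open>The sum of norms over all of \<open>A\<close> dominates every partial sum, so a first
  moment and Markov's inequality suffice, whatever the dependence within a pair.\<close>

lemma near_pairs_bound:
  assumes A: "finite A" and B: "\<And>p. p \<in> A \<Longrightarrow> (\<integral>\<^sup>+\<omega>. ennreal (norm (h (X (fst p) \<omega>) (X (snd p) \<omega>))) \<partial>M) \<le> ennreal B"
    and "B \<ge> 0" and c: "c > 0"
  shows "measure M {\<omega>\<in>space M. \<exists>n\<le>k. c < norm (\<Sum>p\<in>{p\<in>A. snd p \<le> int n}. h (X (fst p) \<omega>) (X (snd p) \<omega>))}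
    \<le> B * real (card A) / c"
proof -
  let ?h = "\<lambda>p \<omega>. norm (h (X (fst p) \<omega>) (X (snd p) \<omega>))"
  have i: "integrable M (?h p) \<and> (\<integral>\<omega>. ?h p \<omega> \<partial>M) \<le> B" if "p \<in> A" for p
  proof
    have "(\<integral>\<^sup>+\<omega>. ennreal (?h p \<omega>) \<partial>M) < \<infinity>"
      using B[OF that] by (rule le_less_trans) simp
    then show int: "integrable M (?h p)"
      by (intro integrableI_bounded) auto
    have "ennreal (\<integral>\<omega>. ?h p \<omega> \<partial>M) \<le> ennreal B"
      using B[OF that] nn_integral_eq_integral[OF int] by simp
    then show "(\<integral>\<omega>. ?h p \<omega> \<partial>M) \<le> B" using \<open>B \<ge> 0\<close> by simp
  qed
  let ?u = "\<lambda>\<omega>. \<Sum>p\<in>A. ?h p \<omega>"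
  have u: "integrable M ?u" using i by (intro Bochner_Integration.integrable_sum) auto
  have "measure M {\<omega>\<in>space M. \<exists>n\<le>k. c < norm (\<Sum>p\<in>{p\<in>A. snd p \<le> int n}. h (X (fst p) \<omega>) (X (snd p) \<omega>))}
    \<le> measure M {\<omega>\<in>space M. ?u \<omega> \<ge> c}"
  proof (rule finite_measure_mono)
    show "{\<omega>\<in>space M. \<exists>n\<le>k. c < norm (\<Sum>p\<in>{p\<in>A. snd p \<le> int n}. h (X (fst p) \<omega>) (X (snd p) \<omega>))}
      \<subseteq> {\<omega>\<in>space M. ?u \<omega> \<ge> c}"
    proof safe
      fix \<omega> n assume "c < norm (\<Sum>p\<in>{p\<in>A. snd p \<le> int n}. h (X (fst p) \<omega>) (X (snd p) \<omega>))"
      also have "\<dots> \<le> (\<Sum>p\<in>{p\<in>A. snd p \<le> int n}. ?h p \<omega>)" by (rule norm_sum)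
      also have "\<dots> \<le> ?u \<omega>" using A by (intro sum_mono2) auto
      finally show "c \<le> ?u \<omega>" by simp
    qed
  qed measurable
  also have "\<dots> \<le> (\<integral>\<omega>. ?u \<omega> \<partial>M) / c"
    by (rule integral_Markov_inequality_measure[OF u sets.top]) (use c in \<open>auto intro!: sum_nonneg\<close>)
  also have "\<dots> \<le> B * real (card A) / c"
  proof (rule divide_right_mono)
    have "(\<integral>\<omega>. ?u \<omega> \<partial>M) = (\<Sum>p\<in>A. \<integral>\<omega>. ?h p \<omega> \<partial>M)" using i by (intro Bochner_Integration.integral_sum) auto
    also have "\<dots> \<le> (\<Sum>p\<in>A. B)" using i by (intro sum_mono) auto
    finally show "(\<integral>\<omega>. ?u \<omega> \<partial>M) \<le> B * real (card A)" by (simp add: mult.commute)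
  qed (use c in simp)
  finally show ?thesis .
qed

end

section \<open>Periods of length 3L and their three shifts\<close>

definition block :: "nat \<Rightarrow> nat \<Rightarrow> int \<Rightarrow> nat" where
  "block L e i = nat ((i + int e * int L) div (3 * int L))"

definition active :: "nat \<Rightarrow> nat \<Rightarrow> int \<Rightarrow> bool" where
  "active L e i \<longleftrightarrow> int L \<le> (i + int e * int L) mod (3 * int L)"

lemma block_bounds:
  assumes "L > 0" "i \<ge> 0"
  shows "3 * int L * int (block L e i) \<le> i + int e * int L"
    and "i + int e * int L < 3 * int L * int (block L e i) + 3 * int L"
    and "active L e i \<Longrightarrow> 3 * int L * int (block L e i) + int L \<le> i + int e * int L"
proof -
  have "0 \<le> (i + int e * int L) div (3 * int L)"
    using assms by (intro pos_imp_zdiv_nonneg_iff[THEN iffD2]) auto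
  then have b: "int (block L e i) = (i + int e * int L) div (3 * int L)" unfolding block_def by simp
  define r where "r = (i + int e * int L) mod (3 * int L)"
  have s: "3 * int L * int (block L e i) + r = i + int e * int L"
    unfolding b r_def by (rule mult_div_mod_eq)
  have r: "0 \<le> r" "r < 3 * int L"
    using assms by (auto simp: r_def intro: pos_mod_sign pos_mod_bound)
  show "3 * int L * int (block L e i) \<le> i + int e * int L" using s r by simp
  show "i + int e * int L < 3 * int L * int (block L e i) + 3 * int L" using s r by simp
  show "3 * int L * int (block L e i) + int L \<le> i + int e * int L" if "active L e i"
    using s that by (simp add: active_def r_def[symmetric])
qed

text \<open>
  An index is inactive for at most one of the three shifts, so two indices leave a shift for
  which both are active.
\<close>

lemma inactive_unique:
  assumes L: "L > 0" and e: "e < 3" "e' < 3" and na: "\<not> active L e i" "\<not> active L e' i"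
  shows "e = e'"
proof -
  define q where "q = (i + int e * int L) div (3 * int L)"
  define q' where "q' = (i + int e' * int L) div (3 * int L)"
  define r where "r = (i + int e * int L) mod (3 * int L)"
  define r' where "r' = (i + int e' * int L) mod (3 * int L)"
  have 1: "3 * int L * q + r = i + int e * int L" "3 * int L * q' + r' = i + int e' * int L"
    unfolding q_def r_def q'_def r'_def by (rule mult_div_mod_eq)+
  have 2: "0 \<le> r" "0 \<le> r'" "r < int L" "r' < int L"
    using L na by (auto simp: active_def r_def r'_def)
  \<comment> \<open>Subtracting the two divisions gives d L = r - r', and both remainders lie in [0,
    L). Hence d = 0, so e and e' agree modulo 3.\<close>
  define d where "d = int e - int e' - 3 * (q - q')"
  have "d * int L = r - r'" using 1 unfolding d_def by (simp add: algebra_simps)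
  moreover have "\<bar>r - r'\<bar> < int L" using 2 by linarith
  ultimately have "\<bar>d\<bar> * int L < 1 * int L" by (metis abs_mult abs_of_nat mult_1)
  then have "\<bar>d\<bar> < 1" by (rule mult_right_less_imp_less) simp
  then have "int e - int e' = 3 * (q - q')" by (simp add: d_def)
  then show ?thesis using e by presburger
qed

lemma ex_common_active:
  assumes "L > 0"
  shows "\<exists>e<3. active L e i \<and> active L e j"
proof (rule ccontr)
  assume "\<not> ?thesis"
  then have "\<not> active L e i \<or> \<not> active L e j" if "e < 3" for e using that by blast
  from this[of 0] this[of 1] this[of 2] show False
    using inactive_unique[OF assms, of 0 1] inactive_unique[OF assms, of 0 2] inactive_unique[OF assms, of 1 2]
    by auto
qed

section \<open>The estimate at one dyadic scale\<close>

context degenerate_kernel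
begin

lemma beta_mix_nonneg: "0 \<le> beta_mix M X L"
proof -
  have "0 \<le> 2 * beta_alg M (gen_sigma M X {1..1}) (gen_sigma M X {1 + int L..})"
    \<comment> \<open>For the empty event the total variation estimate reads 0 <= 2\<beta>.\<close>
    using beta_alg_total_variation[OF prob_space_axioms, of "gen_sigma M X {1..1}" "gen_sigma M X {1 + int L..}" "{}"]
      sets_gen_sigma_subset[of X M, OF X] by simp
  also have "\<dots> \<le> 2 * beta_mix M X L"
    by (intro mult_left_mono beta_alg_le_beta_mix prob_space_axioms X) auto
  finally show ?thesis by simp
qed

lemma U_stat_eq_sum_pairs:
  assumes "n \<le> 2 ^ N"
  shows "U_stat h X n \<omega>
    = (\<Sum>p\<in>{p\<in>{1..2 ^ N} \<times> {1..2 ^ N}. fst p < snd p \<and> snd p \<le> int n}. h (X (fst p) \<omega>) (X (snd p) \<omega>))"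
proof -
  have "int n \<le> int (2 ^ N)" using assms by (simp only: of_nat_le_iff)
  moreover define K :: int where "K = 2 ^ N"
  ultimately have "int n \<le> K" by simp
  then have "{p\<in>{1..K} \<times> {1..K}. fst p < snd p \<and> snd p \<le> int n} = (SIGMA i:{1..int n}. {i<..int n})"
    by auto
  then show ?thesis unfolding U_stat_def K_def by (subst sum.Sigma) (auto simp: case_prod_beta)
qed

text \<open>If the norm exceeds 4c, one of four parts exceeds c: a far class for one of the three
  shifts, or the near pairs. A block holds at most 3L indices, and at most 2^N/L + 1 replacement
  steps are needed per shift.\<close>

lemma dyadic_scale_bound:
  assumes L: "L \<ge> 2" and c: "c > 0" and B0: "B \<ge> 0"
    and B: "\<And>i j. i < j \<Longrightarrow> (\<integral>\<^sup>+\<omega>. ennreal (norm (h (X i \<omega>) (X j \<omega>))) \<partial>M) \<le> ennreal B"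
  shows "measure M {\<omega>\<in>space M. \<exists>n\<le>2 ^ N. 4 * c < norm (U_stat h X n \<omega>)}
    \<le> 3 * (energy * (real (3 * L))\<^sup>2 * 2 ^ N * (real (Suc N))\<^sup>2 * 2 ^ N / c\<^sup>2
      + 2 * (2 ^ N / real L + 1) * beta_mix M X L) + B * (2 ^ N * real (3 * L)) / c"
proof -
  define T where "T = {1..2 ^ N::int}"
  define Tri where "Tri = {p\<in>T \<times> T. fst p < snd p}"
  \<comment> \<open>Choosing one common active shift for each pair makes the classes
    \<open>A e\<close> disjoint, so that no pair is counted twice.\<close>
  define colour where "colour p = (SOME e. e < 3 \<and> active L e (fst p) \<and> active L e (snd p))" for p :: "int \<times> int"
  define A where "A e = {p\<in>Tri. colour p = e \<and> block L e (fst p) < block L e (snd p)}" for e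
  define R where "R = {p\<in>Tri. \<not> block L (colour p) (fst p) < block L (colour p) (snd p)}"
  define S where "S C n \<omega> = (\<Sum>p\<in>{p\<in>C. snd p \<le> int n}. h (X (fst p) \<omega>) (X (snd p) \<omega>))" for C n \<omega>
  \<comment> \<open>The block number of the largest shifted index that can occur, 2^N + 2L; it
    serves all three shifts.\<close>
  define m where "m = nat ((2 ^ N + 2 * int L) div (3 * int L))"
  have L0: "L > 0" using L by simp
  have col: "colour p < 3 \<and> active L (colour p) (fst p) \<and> active L (colour p) (snd p)" for p
    unfolding colour_def by (rule someI_ex) (rule ex_common_active[OF L0])
  have finTri: "finite Tri" unfolding Tri_def T_def by simp
  have Tri_pos: "fst p \<ge> 1 \<and> snd p \<ge> 1" if "p \<in> Tri" for p using that by (auto simp: Tri_def T_def)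
  have split: "U_stat h X n \<omega> = (\<Sum>e<3. S (A e) n \<omega>) + S R n \<omega>" if "n \<le> 2 ^ N" for n \<omega>
  proof -
    let ?F = "\<lambda>p. h (X (fst p) \<omega>) (X (snd p) \<omega>)" and ?R = "\<lambda>C. {p\<in>C. snd p \<le> int n}"
    have "?R Tri = {p\<in>{1..2 ^ N} \<times> {1..2 ^ N}. fst p < snd p \<and> snd p \<le> int n}"
      by (auto simp: Tri_def T_def)
    then have "U_stat h X n \<omega> = sum ?F (?R Tri)" using U_stat_eq_sum_pairs[OF that] by simp
    also have "?R Tri = (\<Union>e<3. ?R (A e)) \<union> ?R R"
      using col by (auto simp: A_def R_def)
    also have "sum ?F \<dots> = sum ?F (\<Union>e<3. ?R (A e)) + sum ?F (?R R)"
      by (rule sum.union_disjoint) (use finTri in \<open>auto simp: A_def R_def\<close>)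
    also have "sum ?F (\<Union>e<3. ?R (A e)) = (\<Sum>e<3. sum ?F (?R (A e)))"
      by (rule sum.UNION_disjoint) (use finTri in \<open>auto simp: A_def\<close>)
    finally show ?thesis unfolding S_def .
  qed
  have mL: "real m \<le> 2 ^ N / real L + 1"
  proof -
    have "int m = (2 ^ N + 2 * int L) div (3 * int L)"
      unfolding m_def using L0 by (simp add: pos_imp_zdiv_nonneg_iff)
    then have "int m * (3 * int L) \<le> 2 ^ N + 2 * int L"
      by (metis div_mod_decomp_int dual_order.trans le_add_same_cancel1 mult.commute order_refl pos_mod_sign L0 of_nat_0_less_iff zero_less_mult_iff zero_less_numeral)
    then have "real_of_int (int m * (3 * int L)) \<le> real_of_int (2 ^ N + 2 * int L)" by (simp only: of_int_le_iff)
    then have "real m * (3 * real L) \<le> 2 ^ N + 2 * real L" by simp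
    then have "3 * (real m * real L) \<le> 2 ^ N + 2 * real L" by (simp add: algebra_simps)
    moreover have "0 \<le> (2::real) ^ N" "0 \<le> real L" by simp_all
    ultimately have "real m * real L \<le> 2 ^ N + real L" by linarith
    then show ?thesis using L0 by (simp add: field_simps)
  qed
  have far: "measure M {\<omega>\<in>space M. \<exists>n\<le>2 ^ N. c < norm (S (A e) n \<omega>)}
    \<le> energy * (real (3 * L))\<^sup>2 * 2 ^ N * (real (Suc N))\<^sup>2 * 2 ^ N / c\<^sup>2 + 2 * (2 ^ N / real L + 1) * beta_mix M X L"
    if e: "e < 3" for e
  proof -
    define J where "J = {i\<in>T. active L e i}"
    have eL: "int e * int L \<le> 2 * int L" using e by (intro mult_right_mono) auto
    note bb = block_bounds[OF L0, of _ e]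
    have J: "J \<subseteq> {1..2 ^ N}" by (auto simp: J_def T_def)
    have J1: "i \<ge> 0" if "i \<in> J" for i using that J by force
    have "measure M {\<omega>\<in>space M. \<exists>n\<le>2 ^ N. c < norm (S (A e) n \<omega>)}
      \<le> energy * (real (3 * L))\<^sup>2 * 2 ^ N * (real (Suc N))\<^sup>2 * 2 ^ N / c\<^sup>2 + 2 * real m * beta_mix M X L"
      unfolding S_def
    proof (rule far_pairs_bound[OF J, where b="block L e"])
      show "block L e i \<le> m" if "i \<in> J" for i
      proof -
        have "i \<le> 2 ^ N" using that J by auto
        with eL have "i + int e * int L \<le> 2 ^ N + 2 * int L" by (rule add_mono[rotated])
        then show ?thesis
          unfolding block_def m_def using L0 by (intro nat_mono zdiv_mono1) auto
      qed
      show "\<exists>l\<ge>1. \<forall>i\<in>J. (block L e i \<le> t \<longrightarrow> i \<le> l) \<and> (block L e i = Suc t \<longrightarrow> l + int L \<le> i)" for t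
      \<comment> \<open>The cut is the last index of period \<open>t\<close>. Active indices of the
        next period start at least L + 1 later, because its first third is discarded. For t = 0 and
        e = 2 the cut is L - 1, which is why L >= 2 is required.\<close>
      proof (intro exI[of _ "3 * int L * int t + 3 * int L - 1 - int e * int L"] conjI ballI impI)
        have "0 \<le> 3 * int L * int t" by simp
        then show "1 \<le> 3 * int L * int t + 3 * int L - 1 - int e * int L" using eL L by linarith
      next
        fix i assume i: "i \<in> J" "block L e i \<le> t"
        then have "3 * int L * int (block L e i) \<le> 3 * int L * int t" by (intro mult_left_mono) auto
        then show "i \<le> 3 * int L * int t + 3 * int L - 1 - int e * int L"
          using bb(2)[OF J1[OF i(1)]] by linarith
      next
        fix i assume i: "i \<in> J" "block L e i = Suc t"
        have "3 * int L * int (Suc t) + int L \<le> i + int e * int L"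
          using bb(3)[OF J1[OF i(1)]] i by (simp add: J_def)
        then show "3 * int L * int t + 3 * int L - 1 - int e * int L + int L \<le> i"
          by (simp add: algebra_simps)
      qed
      show "card {i\<in>J. block L e i = t} \<le> 3 * L" for t
      proof -
        let ?s = "3 * int L * int t - int e * int L"
        have "{i\<in>J. block L e i = t} \<subseteq> {?s..<?s + 3 * int L}"
        proof
          fix i assume i: "i \<in> {i\<in>J. block L e i = t}"
          then have "i \<ge> 0" using J1 by simp
          with bb(1,2)[OF this] i show "i \<in> {?s..<?s + 3 * int L}" by auto
        qed
        then have "card {i\<in>J. block L e i = t} \<le> card {?s..<?s + 3 * int L}" by (intro card_mono) auto
        then show ?thesis by simp
      qed
      show "A e \<subseteq> J \<times> J" using col by (fastforce simp: A_def J_def Tri_def)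
      show "block L e (fst p) < block L e (snd p)" if "p \<in> A e" for p using that by (simp add: A_def)
    qed fact
    also have "\<dots> \<le> energy * (real (3 * L))\<^sup>2 * 2 ^ N * (real (Suc N))\<^sup>2 * 2 ^ N / c\<^sup>2 + 2 * (2 ^ N / real L + 1) * beta_mix M X L"
      using mL beta_mix_nonneg by (intro add_left_mono mult_right_mono) auto
    finally show ?thesis .
  qed
  have cardR: "real (card R) \<le> 2 ^ N * real (3 * L)"
  proof -
    \<comment> \<open>Two indices of one period are less than 3L apart, so each first index has
      fewer than 3L partners.\<close>
    have "R \<subseteq> (SIGMA i:T. {i<..<i + 3 * int L})"
    proof
      fix p assume p: "p \<in> R"
      then have pt: "fst p \<in> T" "fst p < snd p" "fst p \<ge> 0" "snd p \<ge> 0" using Tri_pos by (force simp: R_def Tri_def)+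
      let ?b = "block L (colour p)"
      have "?b (snd p) \<le> ?b (fst p)" using p by (simp add: R_def)
      then have "3 * int L * int (?b (snd p)) \<le> 3 * int L * int (?b (fst p))" by (intro mult_left_mono) auto
      then have "snd p < fst p + 3 * int L"
        using block_bounds(1)[OF L0 pt(3), of "colour p"] block_bounds(2)[OF L0 pt(4), of "colour p"] by linarith
      then show "p \<in> (SIGMA i:T. {i<..<i + 3 * int L})" using pt by (cases p) auto
    qed
    then have "card R \<le> card (SIGMA i:T. {i<..<i + 3 * int L})" by (intro card_mono) (auto simp: T_def)
    also have "\<dots> = (\<Sum>i\<in>T. card {i<..<i + 3 * int L})" by (subst card_SigmaI) (auto simp: T_def)
    also have "\<dots> \<le> (\<Sum>i\<in>T. 3 * L)" by (intro sum_mono) auto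
    also have "\<dots> = 2 ^ N * (3 * L)" by (simp add: T_def nat_power_eq)
    finally have "real (card R) \<le> real (2 ^ N * (3 * L))" by (simp only: of_nat_le_iff)
    then show ?thesis by simp
  qed
  have near: "measure M {\<omega>\<in>space M. \<exists>n\<le>2 ^ N. c < norm (S R n \<omega>)} \<le> B * (2 ^ N * real (3 * L)) / c"
  proof -
    have "measure M {\<omega>\<in>space M. \<exists>n\<le>2 ^ N. c < norm (S R n \<omega>)} \<le> B * real (card R) / c"
      unfolding S_def
    proof (rule near_pairs_bound[OF _ _ B0 c])
      show "finite R" using finTri by (simp add: R_def)
    qed (auto simp: R_def Tri_def intro!: B)
    also have "\<dots> \<le> B * (2 ^ N * real (3 * L)) / c"
      using cardR B0 c by (intro divide_right_mono mult_left_mono) auto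
    finally show ?thesis .
  qed
  let ?E = "\<lambda>C. {\<omega>\<in>space M. \<exists>n\<le>2 ^ N. c < norm (S C n \<omega>)}"
  have S_meas[measurable]: "S C n \<in> borel_measurable M" for C n
    unfolding S_def[abs_def] by measurable
  have E_sets: "?E C \<in> sets M" for C by measurable
  have "{\<omega>\<in>space M. \<exists>n\<le>2 ^ N. 4 * c < norm (U_stat h X n \<omega>)} \<subseteq> (\<Union>e<3. ?E (A e)) \<union> ?E R"
  proof
    fix \<omega> assume "\<omega> \<in> {\<omega>\<in>space M. \<exists>n\<le>2 ^ N. 4 * c < norm (U_stat h X n \<omega>)}"
    then obtain n where \<omega>: "\<omega> \<in> space M" and n: "n \<le> 2 ^ N" "4 * c < norm (U_stat h X n \<omega>)" by blast
    show "\<omega> \<in> (\<Union>e<3. ?E (A e)) \<union> ?E R"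
    proof (rule ccontr)
      assume *: "\<omega> \<notin> (\<Union>e<3. ?E (A e)) \<union> ?E R"
      have far0: "norm (S (A e) n \<omega>) \<le> c" if "e < 3" for e
        using * that \<omega> n(1) not_less by blast
      have near0: "norm (S R n \<omega>) \<le> c"
        using * \<omega> n(1) not_less by blast
      have "norm (U_stat h X n \<omega>) \<le> norm (\<Sum>e<3. S (A e) n \<omega>) + norm (S R n \<omega>)"
        unfolding split[OF n(1)] by (rule norm_triangle_ineq)
      also have "norm (\<Sum>e<3. S (A e) n \<omega>) \<le> (\<Sum>e<3::nat. c)" by (rule sum_norm_le) (use far0 in auto)
      finally show False using near0 n by simp
    qed
  qed
  then have "measure M {\<omega>\<in>space M. \<exists>n\<le>2 ^ N. 4 * c < norm (U_stat h X n \<omega>)}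
    \<le> measure M ((\<Union>e<3. ?E (A e)) \<union> ?E R)"
    using E_sets by (intro finite_measure_mono) auto
  also have "\<dots> \<le> measure M (\<Union>e<3. ?E (A e)) + measure M (?E R)"
    using E_sets by (intro measure_Un_le) auto
  also have "\<dots> \<le> (\<Sum>e<3. measure M (?E (A e))) + measure M (?E R)"
    using E_sets by (intro add_right_mono finite_measure_subadditive_finite) auto
  also have "\<dots> \<le> (\<Sum>e<3::nat. energy * (real (3 * L))\<^sup>2 * 2 ^ N * (real (Suc N))\<^sup>2 * 2 ^ N / c\<^sup>2 + 2 * (2 ^ N / real L + 1) * beta_mix M X L)
    + B * (2 ^ N * real (3 * L)) / c"
    by (intro add_mono sum_mono far near) auto
  finally show ?thesis by simp
qed

end

section \<open>The strong law\<close>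

text \<open>Testing the conditional expectation on the events that Y lies in A and applying Fubini
  shows that the inner integral of \<open>h\<close> has integral zero over every Borel set A, hence
  vanishes almost everywhere.\<close>

lemma degenerate_if_cond_exp_zero:
  fixes Y Y' :: "'v \<Rightarrow> 's::{metric_space, second_countable_topology}"
    and h :: "'s \<Rightarrow> 's \<Rightarrow> 'h::{real_inner, banach, second_countable_topology}"
  assumes N: "prob_space N" and [measurable]: "Y \<in> N \<rightarrow>\<^sub>M borel" "Y' \<in> N \<rightarrow>\<^sub>M borel"
    and \<mu>: "prob_space \<mu>" "sets \<mu> = sets borel"
    and joint: "distr N (borel \<Otimes>\<^sub>M borel) (\<lambda>\<omega>. (Y \<omega>, Y' \<omega>)) = \<mu> \<Otimes>\<^sub>M \<mu>"
    and h[measurable]: "(\<lambda>z. h (fst z) (snd z)) \<in> borel \<Otimes>\<^sub>M borel \<rightarrow>\<^sub>M borel"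
    and ce: "has_cond_exp N (vimage_algebra (space N) Y borel) (\<lambda>\<omega>. h (Y \<omega>) (Y' \<omega>)) (\<lambda>_. 0)"
  shows "AE x in \<mu>. integrable \<mu> (h x) \<and> (\<integral>y. h x y \<partial>\<mu>) = 0"
proof -
  interpret N: prob_space N by fact
  interpret \<mu>: prob_space \<mu> by fact
  interpret pair_prob_space \<mu> \<mu> ..
  let ?h = "\<lambda>z. h (fst z) (snd z)"
  have YY: "(\<lambda>\<omega>. (Y \<omega>, Y' \<omega>)) \<in> N \<rightarrow>\<^sub>M borel \<Otimes>\<^sub>M borel" by measurable
  have "integrable N (\<lambda>\<omega>. h (Y \<omega>) (Y' \<omega>))" using ce by (simp add: has_cond_exp_def)
  then have int: "integrable (\<mu> \<Otimes>\<^sub>M \<mu>) ?h"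
    unfolding joint[symmetric] by (subst integrable_distr_eq[OF YY h]) simp
  have "AE x in \<mu>. (\<integral>y. h x y \<partial>\<mu>) = 0"
  proof (rule \<mu>.density_zero)
    show "integrable \<mu> (\<lambda>x. \<integral>y. h x y \<partial>\<mu>)" using integrable_fst'[OF int] by simp
    fix A assume "A \<in> sets \<mu>"
    then have A: "A \<in> sets borel" using \<mu> by simp
    have ih: "(\<lambda>z. indicat_real A (fst z) *\<^sub>R ?h z) \<in> borel_measurable (borel \<Otimes>\<^sub>M borel)"
      using A by measurable
    have "integrable (\<mu> \<Otimes>\<^sub>M \<mu>) (\<lambda>z. indicat_real A (fst z) *\<^sub>R ?h z)"
    proof (rule Bochner_Integration.integrable_bound[OF int])
      show "(\<lambda>z. indicat_real A (fst z) *\<^sub>R ?h z) \<in> borel_measurable (\<mu> \<Otimes>\<^sub>M \<mu>)"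
        using ih \<mu>(2) by (simp cong: measurable_cong_sets sets_pair_measure_cong)
    qed (auto simp: indicator_def)
    from integral_fst'[OF this]
    have "(\<integral>x. \<integral>y. indicat_real A x *\<^sub>R h x y \<partial>\<mu> \<partial>\<mu>) = (\<integral>z. indicat_real A (fst z) *\<^sub>R ?h z \<partial>(\<mu> \<Otimes>\<^sub>M \<mu>))"
      by simp
    also have "\<dots> = (\<integral>\<omega>. indicat_real A (Y \<omega>) *\<^sub>R h (Y \<omega>) (Y' \<omega>) \<partial>N)"
      unfolding joint[symmetric] by (subst integral_distr[OF YY ih]) simp
    also have "\<dots> = (LINT \<omega>:(Y -` A \<inter> space N)|N. h (Y \<omega>) (Y' \<omega>))"
      unfolding set_lebesgue_integral_def
      by (intro Bochner_Integration.integral_cong refl) (auto simp: indicator_def)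
    also have "\<dots> = 0"
      using ce in_vimage_algebra[OF A, of Y "space N"] by (simp add: has_cond_exp_def)
    finally show "set_lebesgue_integral \<mu> A (\<lambda>x. \<integral>y. h x y \<partial>\<mu>) = 0"
      unfolding set_lebesgue_integral_def by simp
  qed
  moreover have "AE x in \<mu>. integrable \<mu> (h x)" using AE_integrable_fst'[OF int] by simp
  ultimately show ?thesis by eventually_elim simp
qed

section \<open>Consequences of stationarity for single variables and pairs\<close>

lemma strictly_stationary_distr_pair:
  fixes X :: "int \<Rightarrow> 'w \<Rightarrow> 's::{metric_space, second_countable_topology}"
  assumes "strictly_stationary M X" and [measurable]: "\<And>i. X i \<in> M \<rightarrow>\<^sub>M borel"
  shows "distr M (borel \<Otimes>\<^sub>M borel) (\<lambda>\<omega>. (X (i + k) \<omega>, X (j + k) \<omega>))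
    = distr M (borel \<Otimes>\<^sub>M borel) (\<lambda>\<omega>. (X i \<omega>, X j \<omega>))"
proof -
  have m: "(\<lambda>\<omega> l. X (l + k) \<omega>) \<in> M \<rightarrow>\<^sub>M (\<Pi>\<^sub>M i\<in>UNIV. borel)" for k
    by (rule measurable_abs_UNIV) simp
  have eq: "distr M (borel \<Otimes>\<^sub>M borel) (\<lambda>\<omega>. (X (i + k) \<omega>, X (j + k) \<omega>))
    = distr (distr M (\<Pi>\<^sub>M i\<in>UNIV. borel) (\<lambda>\<omega> l. X (l + k) \<omega>)) (borel \<Otimes>\<^sub>M borel) (\<lambda>x. (x i, x j))" for k
    using m[of k] by (subst distr_distr) (auto simp: comp_def)
  show ?thesis
    using eq[of k] eq[of 0] assms(1) unfolding strictly_stationary_def by simp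
qed

lemma strictly_stationary_distr:
  fixes X :: "int \<Rightarrow> 'w \<Rightarrow> 's::{metric_space, second_countable_topology}"
  assumes "strictly_stationary M X" and [measurable]: "\<And>i. X i \<in> M \<rightarrow>\<^sub>M borel"
  shows "distr M borel (X i) = distr M borel (X j)"
proof -
  have "distr M borel (X i) = distr (distr M (borel \<Otimes>\<^sub>M borel) (\<lambda>\<omega>. (X i \<omega>, X i \<omega>))) borel fst" for i
    by (subst distr_distr) (auto simp: comp_def)
  then show ?thesis
    using strictly_stationary_distr_pair[OF assms, of j "i - j" j] by simp
qed

section \<open>Summation and interpolation over dyadic scales\<close>

lemma summable_powr_neg:
  assumes "e > 0"
  shows "summable (\<lambda>N. 2 powr (- e * real N))" "summable (\<lambda>N. (real (Suc N))\<^sup>2 * 2 powr (- e * real N))"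
proof -
  have s: "summable (\<lambda>N. 2 powr (- e * real N))" if "e > 0" for e :: real
  proof -
    have "2 powr (- e * real N) = (2 powr (- e)) ^ N" for N
      by (subst powr_realpow[symmetric]) (simp_all add: powr_powr)
    moreover have "summable (\<lambda>N. (2 powr (- e)) ^ N)"
      using that by (intro summable_geometric) (simp add: powr_less_one)
    ultimately show ?thesis by simp
  qed
  show "summable (\<lambda>N. 2 powr (- e * real N))" by (rule s) fact
  have "(\<lambda>N. (real (Suc N))\<^sup>2 * 2 powr (- e * real N)) \<in> O(\<lambda>N. 2 powr (- (e / 2) * real N))"
    using assms by real_asymp
  then show "summable (\<lambda>N. (real (Suc N))\<^sup>2 * 2 powr (- e * real N))"
    by (rule summable_comparison_test_bigo[rotated]) (use s[of "e / 2"] assms in simp)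
qed

text \<open>For 2^k <= n < 2^(k+1) the bound at scale k+1 applies; rounding up costs only the
  constant factor 2^\<tau>.\<close>

lemma dyadic_growth_imp_tendsto_0:
  fixes u :: "nat \<Rightarrow> real"
  assumes u: "\<And>n. 0 \<le> u n" and "0 < \<tau>" "\<tau> < r"
    and ev: "\<forall>\<^sub>F N in sequentially. \<forall>n\<le>2 ^ N. u n \<le> 2 powr (\<tau> * real N)"
  shows "(\<lambda>n. 1 / real n powr r * u n) \<longlonglongrightarrow> 0"
proof (rule tendsto_sandwich[where f="\<lambda>_. 0" and h="\<lambda>n. 2 powr \<tau> * real n powr (\<tau> - r)"])
  from ev obtain N0 where N0: "\<And>N n. N \<ge> N0 \<Longrightarrow> n \<le> 2 ^ N \<Longrightarrow> u n \<le> 2 powr (\<tau> * real N)"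
    by (auto simp: eventually_sequentially)
  show "\<forall>\<^sub>F n in sequentially. 1 / real n powr r * u n \<le> 2 powr \<tau> * real n powr (\<tau> - r)"
    using eventually_ge_at_top[of "2 ^ N0"]
  proof eventually_elim
    case (elim n)
    have n: "n > 0" using elim by (metis gr0I le_zero_eq power_not_zero zero_neq_numeral)
    obtain k where k: "2 ^ k \<le> n" "n < 2 ^ (k + 1)"
      using ex_power_ivl1[of 2 n] n by auto
    have "(2::nat) ^ N0 < 2 ^ (k + 1)" using elim k by simp
    then have "N0 < k + 1" by (rule power_less_imp_less_exp[rotated]) simp
    then have "u n \<le> 2 powr (\<tau> * real (k + 1))" using N0[of "k + 1" n] k by simp
    also have "\<dots> = 2 powr \<tau> * (2 powr real k) powr \<tau>" by (simp add: powr_powr powr_add[symmetric] algebra_simps)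
    also have "2 powr real k = real (2 ^ k)" by (simp add: powr_realpow)
    also have "real (2 ^ k) powr \<tau> \<le> real n powr \<tau>"
      by (rule powr_mono2) (use k(1) \<open>0 < \<tau>\<close> in \<open>simp_all only: of_nat_le_iff of_nat_0_le_iff less_imp_le\<close>)
    finally have "u n \<le> 2 powr \<tau> * real n powr \<tau>" by simp
    then have "1 / real n powr r * u n \<le> 1 / real n powr r * (2 powr \<tau> * real n powr \<tau>)"
      by (intro mult_left_mono) auto
    also have "\<dots> = 2 powr \<tau> * real n powr (\<tau> - r)" by (simp add: powr_diff)
    finally show ?case .
  qed
  show "(\<lambda>n. 2 powr \<tau> * real n powr (\<tau> - r)) \<longlonglongrightarrow> 0"
    using assms by real_asymp
qed (use u in auto)

theorem theorem1p6:
  fixes M :: "'w measure" and N :: "'v measure"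
    and X :: "int \<Rightarrow> 'w \<Rightarrow> 's::{metric_space, second_countable_topology}"
    and Y Y' :: "'v \<Rightarrow> 's"
    and h :: "'s \<Rightarrow> 's \<Rightarrow> 'h::{real_inner, banach, second_countable_topology}"
    and p \<delta> :: real
  assumes "prob_space M"
    and "\<And>i. X i \<in> M \<rightarrow>\<^sub>M borel"
    and "strictly_stationary M X"
    and "(\<lambda>(x, y). h x y) \<in> borel \<Otimes>\<^sub>M borel \<rightarrow>\<^sub>M borel"
    \<comment> \<open>\<open>(Y, Y')\<close> is \<open>X\<^sub>1\<close> together with an independent copy, on a possibly different
        (for instance enlarged) probability space; \<open>N = M\<close>, \<open>Y = X 1\<close> is allowed\<close>
    and "prob_space N"
    and "Y \<in> N \<rightarrow>\<^sub>M borel" and "Y' \<in> N \<rightarrow>\<^sub>M borel"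
    and "prob_space.indep_var N borel Y borel Y'"
    and "distr N borel Y = distr M borel (X 1)"
    and "distr N borel Y' = distr M borel (X 1)"
    and "has_cond_exp N (vimage_algebra (space N) Y borel) (\<lambda>\<omega>. h (Y \<omega>) (Y' \<omega>)) (\<lambda>_. 0)"
    and "has_cond_exp N (vimage_algebra (space N) Y' borel) (\<lambda>\<omega>. h (Y \<omega>) (Y' \<omega>)) (\<lambda>_. 0)"
    and "1 < p" and "p < 2" and "\<delta> > 0" and "p + \<delta> \<ge> 2"
    and "integrable N (\<lambda>\<omega>. norm (h (Y \<omega>) (Y' \<omega>)) powr (p + \<delta>))"
    and "(SUP j\<in>{2::int..}. \<integral>\<^sup>+\<omega>. ennreal (norm (h (X 1 \<omega>) (X j \<omega>))) \<partial>M) < \<infinity>"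
    and "\<exists>\<eta>>0. summable (\<lambda>k. real (Suc k) powr (2 * (p - 1) / (2 - p) + \<eta>) * beta_mix M X (Suc k))"
  shows "AE \<omega> in M. (\<lambda>n. 1 / real n powr (2 / p) * norm (U_stat h X n \<omega>)) \<longlonglongrightarrow> 0"
proof -
  interpret prob_space M by fact
  interpret N: prob_space N by fact
  note X [measurable] = assms(2)
  note stat = \<open>strictly_stationary M X\<close>
  define \<mu> where "\<mu> = distr M borel (X 1)"
  have h: "(\<lambda>z. h (fst z) (snd z)) \<in> borel \<Otimes>\<^sub>M borel \<rightarrow>\<^sub>M borel"
    using assms(4) by (simp add: case_prod_beta)
  have h': "(\<lambda>z. h (snd z) (fst z)) \<in> borel \<Otimes>\<^sub>M borel \<rightarrow>\<^sub>M borel"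
    using measurable_compose[OF measurable_pair_swap' h] by (simp add: case_prod_beta)
  have Y: "Y \<in> N \<rightarrow>\<^sub>M borel" "Y' \<in> N \<rightarrow>\<^sub>M borel" by fact+
  have \<mu>: "prob_space \<mu>" "sets \<mu> = sets borel"
    unfolding \<mu>_def by (auto intro: prob_space_distr)
  have law: "distr M borel (X i) = \<mu>" for i
    unfolding \<mu>_def by (rule strictly_stationary_distr[OF stat X])
  have joint: "distr N (borel \<Otimes>\<^sub>M borel) (\<lambda>\<omega>. (Y \<omega>, Y' \<omega>)) = \<mu> \<Otimes>\<^sub>M \<mu>"
    using assms(8-10) by (simp add: N.indep_var_distribution_eq \<mu>_def)
  have YY: "(\<lambda>\<omega>. (Y \<omega>, Y' \<omega>)) \<in> N \<rightarrow>\<^sub>M borel \<Otimes>\<^sub>M borel" using Y by measurable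
  interpret \<mu>: prob_space \<mu> by fact
  interpret \<mu>\<mu>: pair_prob_space \<mu> \<mu> ..
  have joint': "distr N (borel \<Otimes>\<^sub>M borel) (\<lambda>\<omega>. (Y' \<omega>, Y \<omega>)) = \<mu> \<Otimes>\<^sub>M \<mu>"
  proof -
    have "distr N (borel \<Otimes>\<^sub>M borel) (\<lambda>\<omega>. (Y' \<omega>, Y \<omega>))
      = distr (distr N (borel \<Otimes>\<^sub>M borel) (\<lambda>\<omega>. (Y \<omega>, Y' \<omega>))) (borel \<Otimes>\<^sub>M borel) (\<lambda>(x, y). (y, x))"
      using YY by (subst distr_distr) (auto simp: comp_def)
    also have "\<dots> = distr (\<mu> \<Otimes>\<^sub>M \<mu>) (\<mu> \<Otimes>\<^sub>M \<mu>) (\<lambda>(x, y). (y, x))"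
      unfolding joint using \<mu>(2) by (intro distr_cong sets_pair_measure_cong) auto
    finally show ?thesis using \<mu>\<mu>.distr_pair_swap by simp
  qed
  have deg2: "AE x in \<mu>. integrable \<mu> (h x) \<and> (\<integral>y. h x y \<partial>\<mu>) = 0"
    by (rule degenerate_if_cond_exp_zero[OF N.prob_space_axioms Y \<mu> joint h]) fact
  have deg1: "AE y in \<mu>. integrable \<mu> (\<lambda>x. h x y) \<and> (\<integral>x. h x y \<partial>\<mu>) = 0"
    by (rule degenerate_if_cond_exp_zero[OF N.prob_space_axioms Y(2,1) \<mu> joint' h']) fact
  have hY: "(\<lambda>\<omega>. h (Y \<omega>) (Y' \<omega>)) \<in> borel_measurable N"
    using measurable_compose[OF YY h] by simp
  have "integrable N (\<lambda>\<omega>. (norm (h (Y \<omega>) (Y' \<omega>)))\<^sup>2)"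
  proof (rule Bochner_Integration.integrable_bound)
    show "integrable N (\<lambda>\<omega>. 1 + norm (h (Y \<omega>) (Y' \<omega>)) powr (p + \<delta>))"
      using assms(17) by simp
    have "x\<^sup>2 \<le> 1 + x powr (p + \<delta>)" if "x \<ge> 0" for x :: real
    proof (cases "x \<le> 1")
      case True
      then have "x\<^sup>2 \<le> 1" using that by (simp add: power_le_one)
      then show ?thesis by (simp add: add_increasing2)
    next
      case False
      then have "x\<^sup>2 = x powr 2" by (simp add: powr_numeral)
      also have "\<dots> \<le> x powr (p + \<delta>)" using False \<open>p + \<delta> \<ge> 2\<close> by (intro powr_mono) auto
      finally show ?thesis by simp
    qed
    then show "AE \<omega> in N. norm ((norm (h (Y \<omega>) (Y' \<omega>)))\<^sup>2) \<le> norm (1 + norm (h (Y \<omega>) (Y' \<omega>)) powr (p + \<delta>))"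
      by (auto simp: abs_of_nonneg)
  qed (use hY in measurable)
  then have sq: "integrable (\<mu> \<Otimes>\<^sub>M \<mu>) (\<lambda>z. (norm (h (fst z) (snd z)))\<^sup>2)"
    unfolding joint[symmetric] using h by (subst integrable_distr_eq[OF YY]) auto
  interpret D: degenerate_kernel M X \<mu> h
    by unfold_locales (use X law assms(4) deg1 deg2 sq in auto)
  define B where "B = enn2real (SUP j\<in>{2::int..}. \<integral>\<^sup>+\<omega>. ennreal (norm (h (X 1 \<omega>) (X j \<omega>))) \<partial>M)"
  have B0: "B \<ge> 0" by (simp add: B_def)
  have Bj: "(\<integral>\<^sup>+\<omega>. ennreal (norm (h (X 1 \<omega>) (X j \<omega>))) \<partial>M) \<le> ennreal B" if "j \<ge> 2" for j
    unfolding B_def using assms(18) that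
    by (subst ennreal_enn2real) (auto intro: SUP_upper)
  have B: "(\<integral>\<^sup>+\<omega>. ennreal (norm (h (X i \<omega>) (X j \<omega>))) \<partial>M) \<le> ennreal B" if "i < j" for i j
  proof -
    have nh: "(\<lambda>z. ennreal (norm (h (fst z) (snd z)))) \<in> borel_measurable (borel \<Otimes>\<^sub>M borel)"
      using h by measurable
    have "(\<integral>\<^sup>+\<omega>. ennreal (norm (h (X i \<omega>) (X j \<omega>))) \<partial>M)
      = (\<integral>\<^sup>+z. ennreal (norm (h (fst z) (snd z))) \<partial>distr M (borel \<Otimes>\<^sub>M borel) (\<lambda>\<omega>. (X i \<omega>, X j \<omega>)))" for i j
      using nh by (subst nn_integral_distr) auto
    note this[of i j]
    also have "distr M (borel \<Otimes>\<^sub>M borel) (\<lambda>\<omega>. (X i \<omega>, X j \<omega>))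
      = distr M (borel \<Otimes>\<^sub>M borel) (\<lambda>\<omega>. (X 1 \<omega>, X (j - i + 1) \<omega>))"
      using strictly_stationary_distr_pair[OF stat X, of 1 "i - 1" "j - i + 1"] by simp
    also have "(\<integral>\<^sup>+z. ennreal (norm (h (fst z) (snd z))) \<partial>\<dots>) = (\<integral>\<^sup>+\<omega>. ennreal (norm (h (X 1 \<omega>) (X (j - i + 1) \<omega>))) \<partial>M)"
      using nh by (subst nn_integral_distr) auto
    also have "\<dots> \<le> ennreal B" using that by (intro Bj) auto
    finally show ?thesis .
  qed
  obtain \<eta> where \<eta>: "\<eta> > 0" "summable (\<lambda>k. real (Suc k) powr (2 * (p - 1) / (2 - p) + \<eta>) * beta_mix M X (Suc k))"
    using assms(19) by blast
  define \<alpha> where "\<alpha> = 2 * (p - 1) / (2 - p) + \<eta>"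
  have \<alpha>: "\<alpha> > 0" unfolding \<alpha>_def using \<eta>(1) \<open>1 < p\<close> \<open>p < 2\<close> by (intro add_pos_pos) auto
  \<comment> \<open>Here 1 + \<alpha> = p/(2-p) + \<eta>. The inequality is the condition
    1/(1+\<alpha>) < (2-p)/p cleared of denominators.\<close>
  have a1: "(1 + \<alpha>) * (2 - p) > p"
  proof -
    have "(1 + \<alpha>) * (2 - p) = p + \<eta> * (2 - p)"
      unfolding \<alpha>_def using \<open>p < 2\<close> by (simp add: field_simps)
    then show ?thesis using \<eta>(1) \<open>p < 2\<close> by simp
  qed
  \<comment> \<open>Boundedness of the summands already gives the polynomial rate \<beta>(L) <= C
    L^(-\<alpha>), which is what the choice of block length uses.\<close>
  obtain C where C: "C > 0" "\<And>L. L \<ge> 1 \<Longrightarrow> real L powr \<alpha> * beta_mix M X L \<le> C"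
  proof -
    have "Bseq (\<lambda>k. real (Suc k) powr \<alpha> * beta_mix M X (Suc k))"
      using summable_LIMSEQ_zero[OF \<eta>(2)] unfolding \<alpha>_def[symmetric]
      by (intro convergent_imp_Bseq) (auto simp: convergent_def)
    then obtain C where "C > 0" "\<And>k. norm (real (Suc k) powr \<alpha> * beta_mix M X (Suc k)) \<le> C"
      by (auto simp: Bseq_def)
    moreover have "real L powr \<alpha> * beta_mix M X L \<le> C" if "L \<ge> 1" for L
    proof -
      obtain k where "L = Suc k" using \<open>L \<ge> 1\<close> by (cases L) auto
      then show ?thesis using abs_le_D1[OF calculation(2)[of k, unfolded real_norm_def]] by simp
    qed
    ultimately show ?thesis using that by blast
  qed
  have "1 / (1 + \<alpha>) < (2 - p) / p"
    using a1 \<alpha> \<open>1 < p\<close> by (simp add: field_simps)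
  then obtain \<gamma> where \<gamma>: "1 / (1 + \<alpha>) < \<gamma>" "\<gamma> < (2 - p) / p" using dense by blast
  have \<gamma>0: "\<gamma> > 0" using \<gamma>(1) \<alpha> by (smt (verit) divide_pos_pos)
  have \<gamma>1: "\<gamma> < 1" using \<gamma>(2) \<open>1 < p\<close> by (smt (verit) less_divide_eq_1_pos)
  have "1 + \<gamma> < 2 / p" using \<gamma>(2) \<open>1 < p\<close> by (simp add: field_simps)
  then obtain \<tau> where \<tau>: "1 + \<gamma> < \<tau>" "\<tau> < 2 / p" using dense by blast
  \<comment> \<open>The decay rates per scale: \<open>e1\<close> for the replacement error (2^N/L)
    \<beta>(L), and \<open>e2\<close> for 2^N L divided by the threshold 2^(\<tau> N). The latter
    occurs squared in the second moment error.\<close>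
  define e1 where "e1 = \<gamma> * (1 + \<alpha>) - 1"
  define e2 where "e2 = \<tau> - 1 - \<gamma>"
  have e1: "e1 > 0" using \<gamma>(1) \<alpha> by (simp add: e1_def field_simps)
  have e2: "e2 > 0" using \<tau> by (simp add: e2_def)
  define En where "En N = {\<omega>\<in>space M. \<exists>n\<le>2 ^ N. 2 powr (\<tau> * real N) < norm (U_stat h X n \<omega>)}" for N
  \<comment> \<open>The factor 3 counts the shifts. Since 36 * 16 = 24^2, the rest is the square of
    the bound 24 x^(-e2) for 3 L x / c, obtained from L <= 2 x^\<gamma> and c = x^\<tau>/4.\<close>
  define K where "K = 3 * 36 * 16 * D.energy"
  have U_meas: "U_stat h X n \<in> borel_measurable M" for n
    unfolding U_stat_def[abs_def] using D.h_measurable by measurable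
  have En_sets: "En N \<in> sets M" for N
    unfolding En_def using U_meas by measurable
  have bound: "measure M (En N) \<le> K * ((real (Suc N))\<^sup>2 * 2 powr (- (2 * e2) * real N))
      + 12 * C * 2 powr (- e1 * real N) + 24 * B * 2 powr (- e2 * real N)"
    if N: "N \<ge> 1" for N
  proof -
    define x where "x = (2::real) ^ N"
    have x1: "x \<ge> 1" by (simp add: x_def)
    have px: "2 powr (a * real N) = x powr a" for a
    proof -
      have "x = 2 powr real N" by (simp add: x_def powr_realpow)
      then show ?thesis by (simp only: powr_powr mult.commute)
    qed
    have expo: "x powr \<gamma> * x powr 1 / x powr \<tau> = x powr (- e2)"
    proof -
      have "- e2 = \<gamma> + 1 - \<tau>" by (simp add: e2_def)
      then show ?thesis by (simp only: powr_add powr_diff)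
    qed
    \<comment> \<open>For N >= 1 the power x^\<gamma> exceeds 1, so rounding up at most doubles it
      and yields L >= 2.\<close>
    define L where "L = nat \<lceil>x powr \<gamma>\<rceil>"
    have xg: "x powr \<gamma> > 1"
      unfolding px[symmetric] using \<gamma>0 N by simp
    have L: "x powr \<gamma> \<le> real L" "real L \<le> 2 * x powr \<gamma>" "L \<ge> 2"
      using xg unfolding L_def by linarith+
    have L0: "real L > 0" using L(3) by simp
    have b: "beta_mix M X L \<le> C * x powr (- \<gamma> * \<alpha>)"
    proof -
      have "x powr (\<gamma> * \<alpha>) \<le> real L powr \<alpha>"
        using L(1) \<alpha> by (simp add: powr_powr[symmetric] powr_mono2)
      moreover have "real L powr \<alpha> * beta_mix M X L \<le> C" using C(2) L(3) by simp
      ultimately have "x powr (\<gamma> * \<alpha>) * beta_mix M X L \<le> C"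
        using D.beta_mix_nonneg[of L] by (meson mult_right_mono order_trans)
      then show ?thesis using x1 by (simp add: powr_minus field_simps)
    qed
    have xL: "x / real L + 1 \<le> 2 * x powr (1 - \<gamma>)"
    proof -
      have "x / real L \<le> x / x powr \<gamma>" using L(1) xg x1 by (intro divide_left_mono) auto
      also have "\<dots> = x powr (1 - \<gamma>)" using x1 by (simp add: powr_diff)
      finally have "x / real L \<le> x powr (1 - \<gamma>)" .
      moreover have "1 \<le> x powr (1 - \<gamma>)" using x1 \<gamma>1 by (intro ge_one_powr_ge_zero) auto
      ultimately show ?thesis by simp
    qed
    \<comment> \<open>A quarter of the threshold, to match the split into four parts in
      \<open>dyadic_scale_bound\<close>.\<close>
    define c where "c = x powr \<tau> / 4"
    have c: "c > 0" using x1 by (simp add: c_def)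
    have t1: "D.energy * (real (3 * L))\<^sup>2 * 2 ^ N * (real (Suc N))\<^sup>2 * 2 ^ N / c\<^sup>2
      \<le> 36 * 16 * D.energy * ((real (Suc N))\<^sup>2 * 2 powr (- (2 * e2) * real N))"
    proof -
      have "D.energy * (real (3 * L))\<^sup>2 * 2 ^ N * (real (Suc N))\<^sup>2 * 2 ^ N / c\<^sup>2
        = D.energy * (real (Suc N))\<^sup>2 * (3 * real L * x / c)\<^sup>2"
        by (simp add: x_def power2_eq_square field_simps)
      also have "3 * real L * x / c \<le> 24 * x powr (- e2)"
      proof -
        have "3 * real L * x / c \<le> 3 * (2 * x powr \<gamma>) * x / c"
          using L(2) c x1 by (intro divide_right_mono mult_right_mono mult_left_mono) auto
        also have "\<dots> = 24 * (x powr \<gamma> * x powr 1 / x powr \<tau>)"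
          using x1 by (simp add: c_def)
        finally show ?thesis by (simp only: expo)
      qed
      then have "(3 * real L * x / c)\<^sup>2 \<le> (24 * x powr (- e2))\<^sup>2"
        using c x1 by (intro power_mono) auto
      also have "(24 * x powr (- e2))\<^sup>2 = 36 * 16 * x powr (- (2 * e2))"
        using x1 by (simp add: power_mult_distrib power2_eq_square powr_add[symmetric])
      finally show ?thesis using D.energy_nonneg unfolding px
        by (simp add: mult_left_mono mult.assoc mult.left_commute)
    qed
    have t2: "2 * (2 ^ N / real L + 1) * beta_mix M X L \<le> 4 * C * 2 powr (- e1 * real N)"
    proof -
      have "(x / real L + 1) * beta_mix M X L \<le> (2 * x powr (1 - \<gamma>)) * (C * x powr (- \<gamma> * \<alpha>))"
        using xL b D.beta_mix_nonneg[of L] L0 x1 by (intro mult_mono) auto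
      also have "\<dots> = 2 * C * x powr (- e1)"
        using x1 by (simp add: e1_def powr_add[symmetric] algebra_simps)
      finally show ?thesis unfolding px x_def[symmetric] by (simp only: mult.assoc)
    qed
    have t3: "B * (2 ^ N * real (3 * L)) / c \<le> 24 * B * 2 powr (- e2 * real N)"
    proof -
      have "B * (2 ^ N * real (3 * L)) / c = B * (3 * real L * x / c)" by (simp add: x_def)
      also have "\<dots> \<le> B * (3 * (2 * x powr \<gamma>) * x / c)"
        using L(2) c x1 B0 by (intro mult_left_mono divide_right_mono mult_right_mono) auto
      also have "3 * (2 * x powr \<gamma>) * x / c = 24 * (x powr \<gamma> * x powr 1 / x powr \<tau>)"
        using x1 by (simp add: c_def)
      finally show ?thesis by (simp only: expo px mult.assoc mult.left_commute)
    qed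
    have "measure M (En N) = measure M {\<omega>\<in>space M. \<exists>n\<le>2 ^ N. 4 * c < norm (U_stat h X n \<omega>)}"
      unfolding En_def px by (simp add: c_def)
    also have "\<dots> \<le> 3 * (D.energy * (real (3 * L))\<^sup>2 * 2 ^ N * (real (Suc N))\<^sup>2 * 2 ^ N / c\<^sup>2
      + 2 * (2 ^ N / real L + 1) * beta_mix M X L) + B * (2 ^ N * real (3 * L)) / c"
      by (rule D.dyadic_scale_bound[OF L(3) c B0 B])
    also have "\<dots> \<le> 3 * (36 * 16 * D.energy * ((real (Suc N))\<^sup>2 * 2 powr (- (2 * e2) * real N))
      + 4 * C * 2 powr (- e1 * real N)) + 24 * B * 2 powr (- e2 * real N)"
      by (intro add_mono mult_left_mono t1 t2 t3) auto
    finally show ?thesis by (simp add: K_def algebra_simps)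
  qed
  have "summable (\<lambda>N. measure M (En N))"
  proof (rule summable_comparison_test')
    show "summable (\<lambda>N. K * ((real (Suc N))\<^sup>2 * 2 powr (- (2 * e2) * real N))
      + 12 * C * 2 powr (- e1 * real N) + 24 * B * 2 powr (- e2 * real N))"
      using e1 e2 by (intro summable_add summable_mult summable_powr_neg) auto
    show "norm (measure M (En N)) \<le> K * ((real (Suc N))\<^sup>2 * 2 powr (- (2 * e2) * real N))
      + 12 * C * 2 powr (- e1 * real N) + 24 * B * 2 powr (- e2 * real N)" if "N \<ge> 1" for N
      using bound[OF that] by simp
  qed
  then have "AE \<omega> in M. \<forall>\<^sub>F N in sequentially. \<omega> \<in> space M - En N"
    using En_sets by (intro borel_cantelli_AE1) (auto simp: emeasure_eq_measure)
  then show ?thesis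
  proof eventually_elim
    case (elim \<omega>)
    then have "\<forall>\<^sub>F N in sequentially. \<forall>n\<le>2 ^ N. norm (U_stat h X n \<omega>) \<le> 2 powr (\<tau> * real N)"
      by eventually_elim (auto simp: En_def not_less)
    then show ?case
      using \<tau> \<gamma>0 by (intro dyadic_growth_imp_tendsto_0[where \<tau>=\<tau>]) auto
  qed
qed

end
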